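(* Let $K=\mathbb{Q}(\zeta_7+\zeta_7^{-1})$, where $\zeta_7$ is a primitive seventh root of unity, and let $\mathcal{O}_K$ be its ring of integers. The quadratic form \[ x^2+xy+y^2+yz-xw+z^2+zw+w^2 \] is universal over $K$, i.e. for every totally positive $\lambda\in\mathcal{O}_K$ there exist $x,y,z,w\in\mathcal{O}_K$ with $x^2+xy+y^2+yz-xw+z^2+zw+w^2=\lambda$.
   Context: An element $\lambda$ of a totally real field $K$ is totally positive if $\sigma(\lambda)>0$ for every real embedding $\sigma$ of $K$. *)

theory Defs
  imports Complex_Main
    "HOL-Computational_Algebra.Polynomial"
    "HOL-Algebra.Generated_Fields"
    "HOL-Algebra.Algebraic_Closure_Type"
begin

definition primitive_root_of_unity :: "nat \<Rightarrow> 'a::field \<Rightarrow> bool" where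
  "primitive_root_of_unity n z \<longleftrightarrow>
     0 < n \<and> z ^ n = 1 \<and> (\<forall>k. 0 < k \<and> k < n \<longrightarrow> z ^ k \<noteq> 1)"

text \<open>Number fields are represented as subsets of the complex numbers.\<close>

definition rat_adjoin :: "complex \<Rightarrow> complex set" where
  "rat_adjoin a = generate_field (ring_of_type_algebra :: complex ring) (\<rat> \<union> {a})"

definition ring_of_integers :: "complex set \<Rightarrow> complex set" where
  "ring_of_integers K = {x \<in> K. algebraic_int x}"

text \<open>An element of \<open>ring_hom\<close> preserves \<open>1\<close>, so it is automatically injective when its
  domain is a field. Its values outside \<open>K\<close> are unconstrained and irrelevant.\<close>

definition real_embeddings :: "complex set \<Rightarrow> (complex \<Rightarrow> real) set" where
  "real_embeddings K =
     ring_hom ((ring_of_type_algebra :: complex ring)\<lparr>carrier := K\<rparr>)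
              (ring_of_type_algebra :: real ring)"

definition totally_positive :: "complex set \<Rightarrow> complex \<Rightarrow> bool" where
  "totally_positive K l \<longleftrightarrow> l \<in> K \<and> (\<forall>\<sigma>\<in>real_embeddings K. \<sigma> l > 0)"

end

theory Submission
  imports Defs "HOL-Computational_Algebra.Primes" "HOL-Library.Product_Plus"
begin

text \<open>The form is the reduced norm of the Hurwitz order \<open>O\<close> of \<open>K\<close>-quaternions, hence multiplicative.
  The ring \<open>\<int>[\<rho>]\<close> of integers is Euclidean, so a totally positive \<open>\<lambda>\<close> factors into rational primes,
  which are reduced norms of Hurwitz quaternions, and totally positive divisors of elements \<open>\<rho> - r\<close>
  with \<open>r \<in> \<int>\<close>. For such a divisor \<open>\<lambda>\<close> choose a Hurwitz quaternion \<open>\<beta>\<close> of norm \<open>N(\<lambda>)\<close>. On the lattice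
  generated by \<open>\<beta>\<close>, \<open>\<rho> - r\<close> and \<open>\<rho>\<^sup>2 - r\<^sup>2\<close> over the Hurwitz quaternions the Hermitian form
  \<open>Tr(u v\<^sup>*/\<lambda>)\<close> is integral of determinant 49 and has rank one modulo 7; Hermite reduction then gives a
  nonzero vector of norm at most 6. Hence \<open>\<lambda>\<mu>\<close> is a reduced norm for some totally positive \<open>\<mu>\<close> of
  trace at most 6, and such a \<open>\<mu>\<close> is the square of a unit or equal to 2. In the latter case the factor
  \<open>1 + i\<close> can be split off.\<close>

section \<open>The cubic ring\<close>

text \<open>If \<open>l\<close> divides rho - k, its residue ring is Z/N(l) and rho acts like k
  modulo \<open>l\<close>. Hence one quaternion \<open>beta\<close> with integer coordinates,
  together with multiples of \<open>l\<close>, already gives a module over Z[rho], and three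
  generators over the rational Hurwitz order suffice. The determinant 49 is the discriminant of K
  and does not depend on \<open>l\<close>, so neither does the bound on a shortest vector. The
  margin is thin: Hermite's inequalities alone allow the minimum 7, and trace 7 is attained by 2 -
  rho, which is totally positive of norm 7 and no unit. The way out is that 7 is totally ramified: a
  form of rank one over K still has rank one modulo 7 after taking traces, and this rules out 7.
  That Z[rho] is the full ring of integers is proved as well. Traces and the dual basis bound
  denominators by the different, which is (2 - rho)^2 up to a unit, and norms at the primes 2 - rho
  and 2 remove what is left. All arithmetic takes place on integer triples; the subfield of the
  complex numbers enters only at the end.\<close>

text \<open>\<open>Cub a b c\<close> stands for \<open>a + b\<rho> + c\<rho>\<^sup>2\<close>, where \<open>\<rho> = \<zeta> + \<zeta>\<inverse>\<close> is a root of \<open>X\<^sup>3 + X\<^sup>2 - 2X - 1\<close>.\<close>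

datatype cub = Cub (cf0: int) (cf1: int) (cf2: int)

lemma cub_eq_iff: "x = y \<longleftrightarrow> cf0 x = cf0 y \<and> cf1 x = cf1 y \<and> cf2 x = cf2 y"
  by (cases x; cases y) simp

instantiation cub :: comm_ring_1
begin

definition "0 = Cub 0 0 0"
definition "1 = Cub 1 0 0"
definition "x + y = Cub (cf0 x + cf0 y) (cf1 x + cf1 y) (cf2 x + cf2 y)"
definition "x - y = Cub (cf0 x - cf0 y) (cf1 x - cf1 y) (cf2 x - cf2 y)"
definition "- x = Cub (- cf0 x) (- cf1 x) (- cf2 x)"
definition "x * y =
  (let p0 = cf0 x * cf0 y; p1 = cf0 x * cf1 y + cf1 x * cf0 y;
       p2 = cf0 x * cf2 y + cf1 x * cf1 y + cf2 x * cf0 y;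
       p3 = cf1 x * cf2 y + cf2 x * cf1 y; p4 = cf2 x * cf2 y
   in Cub (p0 + p3 - p4) (p1 + 2 * p3 - p4) (p2 - p3 + 3 * p4))"

instance
  by standard
    (auto simp: zero_cub_def one_cub_def plus_cub_def minus_cub_def uminus_cub_def times_cub_def
      Let_def algebra_simps)

end

lemma cub_sel [simp]:
  "cf0 0 = 0" "cf1 0 = 0" "cf2 0 = 0"
  "cf0 1 = 1" "cf1 1 = 0" "cf2 1 = 0"
  "cf0 (x + y) = cf0 x + cf0 y" "cf1 (x + y) = cf1 x + cf1 y" "cf2 (x + y) = cf2 x + cf2 y"
  "cf0 (x - y) = cf0 x - cf0 y" "cf1 (x - y) = cf1 x - cf1 y" "cf2 (x - y) = cf2 x - cf2 y"
  "cf0 (- x) = - cf0 x" "cf1 (- x) = - cf1 x" "cf2 (- x) = - cf2 x"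
  by (simp_all add: zero_cub_def one_cub_def plus_cub_def minus_cub_def uminus_cub_def)

lemma cub_sel_times:
  "cf0 (x * y) = cf0 x * cf0 y + (cf1 x * cf2 y + cf2 x * cf1 y) - cf2 x * cf2 y"
  "cf1 (x * y) = cf0 x * cf1 y + cf1 x * cf0 y + 2 * (cf1 x * cf2 y + cf2 x * cf1 y) - cf2 x * cf2 y"
  "cf2 (x * y) = cf0 x * cf2 y + cf1 x * cf1 y + cf2 x * cf0 y
     - (cf1 x * cf2 y + cf2 x * cf1 y) + 3 * (cf2 x * cf2 y)"
  by (simp_all add: times_cub_def Let_def)

lemma of_nat_cub: "of_nat n = Cub (int n) 0 0"
  by (induction n) (auto simp: cub_eq_iff)

lemma of_int_cub: "of_int k = Cub k 0 0"
  by (cases k) (auto simp: cub_eq_iff of_nat_cub)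

lemma cub_sel_of_int [simp]: "cf0 (of_int k) = k" "cf1 (of_int k) = 0" "cf2 (of_int k) = 0"
  by (simp_all add: of_int_cub)

lemma cub_sel_numeral [simp]:
  "cf0 (numeral k) = numeral k" "cf1 (numeral k) = 0" "cf2 (numeral k) = 0"
  using cub_sel_of_int[of "numeral k"] by simp_all

lemma cub_of_int_dvd_iff:
  "(of_int k :: cub) dvd x \<longleftrightarrow> k dvd cf0 x \<and> k dvd cf1 x \<and> k dvd cf2 x"
proof
  assume "of_int k dvd x"
  then show "k dvd cf0 x \<and> k dvd cf1 x \<and> k dvd cf2 x"
    by (auto simp: cub_sel_times elim!: dvdE)
next
  assume "k dvd cf0 x \<and> k dvd cf1 x \<and> k dvd cf2 x"
  then obtain a b c where "cf0 x = k * a" "cf1 x = k * b" "cf2 x = k * c"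
    by (auto elim!: dvdE)
  then have "x = of_int k * Cub a b c"
    by (auto simp: cub_eq_iff cub_sel_times)
  then show "of_int k dvd x"
    by simp
qed

definition cub_rho :: cub where "cub_rho = Cub 0 1 0"

lemma cub_sel_rho [simp]: "cf0 cub_rho = 0" "cf1 cub_rho = 1" "cf2 cub_rho = 0"
  by (simp_all add: cub_rho_def)

text \<open>The Galois conjugation \<open>\<rho> \<mapsto> \<rho>\<^sup>2 - 2\<close>.\<close>

definition cub_conj :: "cub \<Rightarrow> cub" where
  "cub_conj x = Cub (cf0 x - 2 * cf1 x + 3 * cf2 x) (- cf2 x) (cf1 x - cf2 x)"

lemma cub_sel_conj [simp]:
  "cf0 (cub_conj x) = cf0 x - 2 * cf1 x + 3 * cf2 x" "cf1 (cub_conj x) = - cf2 x"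
  "cf2 (cub_conj x) = cf1 x - cf2 x"
  by (simp_all add: cub_conj_def)

lemma cub_conj_conj_conj: "cub_conj (cub_conj (cub_conj x)) = x"
  by (simp add: cub_eq_iff)

lemma cub_conj_mult: "cub_conj (x * y) = cub_conj x * cub_conj y"
  by (simp add: cub_eq_iff cub_sel_times algebra_simps)

definition cub_trace :: "cub \<Rightarrow> int" where
  "cub_trace x = 3 * cf0 x - cf1 x + 5 * cf2 x"

definition cub_adj :: "cub \<Rightarrow> cub" where
  "cub_adj x = cub_conj x * cub_conj (cub_conj x)"

definition cub_norm :: "cub \<Rightarrow> int" where
  "cub_norm x = (let a = cf0 x; b = cf1 x; c = cf2 x in
     a^3 - a^2 * b + 5 * a^2 * c - 2 * a * b^2 - a * b * c + 6 * a * c^2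
     + b^3 - b^2 * c - 2 * b * c^2 + c^3)"

text \<open>Second elementary symmetric function of the conjugates; with \<open>cub_trace\<close>
  and \<open>cub_norm\<close> it makes up the characteristic polynomial.\<close>

definition cub_pairs :: "cub \<Rightarrow> int" where
  "cub_pairs x = (let a = cf0 x; b = cf1 x; c = cf2 x in
     3 * a^2 - 2 * a * b + 10 * a * c - 2 * b^2 - b * c + 6 * c^2)"

lemma cub_trace_conj: "of_int (cub_trace x) = x + cub_conj x + cub_conj (cub_conj x)"
  unfolding of_int_cub by (simp add: cub_eq_iff cub_trace_def)

lemma cub_norm_conj: "of_int (cub_norm x) = x * cub_conj x * cub_conj (cub_conj x)"
  unfolding of_int_cub
  by (simp add: cub_eq_iff cub_norm_def cub_sel_times Let_def algebra_simps power2_eq_square power3_eq_cube)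

lemma cub_norm_adj: "of_int (cub_norm x) = x * cub_adj x"
  by (simp add: cub_norm_conj cub_adj_def mult.assoc)

lemma cub_pairs_conj:
  "of_int (cub_pairs x) = x * cub_conj x + x * cub_conj (cub_conj x) + cub_conj x * cub_conj (cub_conj x)"
  unfolding of_int_cub
  by (simp add: cub_eq_iff cub_pairs_def cub_sel_times Let_def algebra_simps power2_eq_square power3_eq_cube)

lemma of_int_cub_eq_iff [simp]: "(of_int a :: cub) = of_int b \<longleftrightarrow> a = b"
  by (auto simp: cub_eq_iff)

lemma cub_norm_mult: "cub_norm (x * y) = cub_norm x * cub_norm y"
proof -
  have "(of_int (cub_norm (x * y)) :: cub) = of_int (cub_norm x * cub_norm y)"
    by (simp only: cub_norm_conj of_int_mult) (simp add: cub_conj_mult algebra_simps)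
  then show ?thesis
    by (simp only: of_int_cub_eq_iff)
qed

lemma cub_norm_of_int [simp]: "cub_norm (of_int k) = k ^ 3"
  by (simp add: cub_norm_def Let_def)

lemma cub_norm_0 [simp]: "cub_norm 0 = 0" and cub_norm_1 [simp]: "cub_norm 1 = 1"
  by (simp_all add: cub_norm_def Let_def)

lemma cub_norm_numeral [simp]: "cub_norm (numeral k) = numeral k ^ 3"
  using cub_norm_of_int[of "numeral k"] by simp

lemma cub_norm_power: "cub_norm (x ^ k) = cub_norm x ^ k"
  by (induction k) (auto simp: cub_norm_mult)

lemma cub_norm_minus: "cub_norm (- x) = - cub_norm x"
  by (simp add: cub_norm_def Let_def)

lemma cub_norm_conj_eq: "cub_norm (cub_conj x) = cub_norm x"
  by (simp add: cub_norm_def Let_def algebra_simps power2_eq_square power3_eq_cube)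

lemma cub_trace_of_int_mult: "cub_trace (of_int k * x) = k * cub_trace x"
  by (simp add: cub_trace_def cub_sel_times algebra_simps)

text \<open>The prime 2 is inert.\<close>

lemma even_cub_norm_imp:
  assumes "even (cub_norm x)"
  shows "(2 :: cub) dvd x"
proof -
  \<comment> \<open>The norm is odd on each of the seven nonzero parity classes.\<close>
  have "even (cf0 x) \<and> even (cf1 x) \<and> even (cf2 x)"
    using assms by (cases "even (cf0 x)"; cases "even (cf1 x)"; cases "even (cf2 x)")
      (auto simp: cub_norm_def Let_def)
  then show ?thesis
    using cub_of_int_dvd_iff[of 2 x] by simp
qed

text \<open>Infinite descent: an element of norm 0 is divisible by 2, and its half again has norm 0.
  This yields the integral domain without any embedding.\<close>

lemma cub_norm_eq_0_iff [simp]: "cub_norm x = 0 \<longleftrightarrow> x = 0"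
proof
  show "cub_norm x = 0 \<Longrightarrow> x = 0"
  proof (induction "nat (\<bar>cf0 x\<bar> + \<bar>cf1 x\<bar> + \<bar>cf2 x\<bar>)" arbitrary: x rule: less_induct)
    case less
    obtain y where y: "x = 2 * y"
      using even_cub_norm_imp[of x] less.prems by (auto elim!: dvdE)
    show ?case
    proof (rule ccontr)
      assume "x \<noteq> 0"
      have "cub_norm y = 0"
        using less.prems by (simp add: y cub_norm_mult)
      moreover have "nat (\<bar>cf0 y\<bar> + \<bar>cf1 y\<bar> + \<bar>cf2 y\<bar>) < nat (\<bar>cf0 x\<bar> + \<bar>cf1 x\<bar> + \<bar>cf2 x\<bar>)"
        using \<open>x \<noteq> 0\<close> unfolding y by (auto simp: cub_eq_iff cub_sel_times)
      ultimately have "y = 0"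
        using less.hyps by blast
      with y \<open>x \<noteq> 0\<close> show False
        by simp
    qed
  qed
qed simp

instance cub :: idom
proof
  fix x y :: cub
  assume "x \<noteq> 0" "y \<noteq> 0"
  then have "cub_norm (x * y) \<noteq> 0"
    by (simp add: cub_norm_mult)
  then show "x * y \<noteq> 0"
    by auto
qed

instance cub :: ring_char_0
proof
  show "inj (of_nat :: nat \<Rightarrow> cub)"
    by (auto simp: inj_def of_nat_cub)
qed

subsection \<open>Evaluation at a root\<close>

text \<open>The ring and \<open>r\<close> are arbitrary: real and complex roots give embeddings, and
  an integer \<open>r\<close> with \<open>p dvd cub_poly r\<close> gives reduction at a degree-one
  prime above p.\<close>

definition cub_eval :: "'a::comm_ring_1 \<Rightarrow> cub \<Rightarrow> 'a" where
  "cub_eval r x = of_int (cf0 x) + of_int (cf1 x) * r + of_int (cf2 x) * r\<^sup>2"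

definition cub_poly :: "'a::comm_ring_1 \<Rightarrow> 'a" where
  "cub_poly r = r ^ 3 + r\<^sup>2 - 2 * r - 1"

lemma cub_eval_add: "cub_eval r (x + y) = cub_eval r x + cub_eval r y"
  by (simp add: cub_eval_def algebra_simps)

lemma cub_eval_diff: "cub_eval r (x - y) = cub_eval r x - cub_eval r y"
  by (simp add: cub_eval_def algebra_simps)

lemma cub_eval_uminus: "cub_eval r (- x) = - cub_eval r x"
  by (simp add: cub_eval_def algebra_simps)

lemma cub_eval_of_int [simp]: "cub_eval r (of_int k) = of_int k"
  by (simp add: cub_eval_def)

lemma cub_eval_numeral [simp]: "cub_eval r (numeral k) = numeral k"
  by (simp add: cub_eval_def)

lemma cub_eval_0 [simp]: "cub_eval r 0 = 0" and cub_eval_1 [simp]: "cub_eval r 1 = 1"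
  by (simp_all add: cub_eval_def)

lemma cub_eval_rho [simp]: "cub_eval r cub_rho = r"
  by (simp add: cub_eval_def)

text \<open>The defect is an explicit multiple of \<open>cub_poly r\<close>, so that the identity
  serves exact roots and roots modulo p alike.\<close>

lemma cub_eval_mult_diff:
  "cub_eval r x * cub_eval r y - cub_eval r (x * y) =
    cub_poly r * (of_int (cf2 x * cf2 y) * r + of_int (cf1 x * cf2 y + cf2 x * cf1 y - cf2 x * cf2 y))"
  by (simp add: cub_eval_def cub_poly_def cub_sel_times algebra_simps power2_eq_square power3_eq_cube)

lemma cub_eval_mult:
  "cub_poly r = 0 \<Longrightarrow> cub_eval r (x * y) = cub_eval r x * cub_eval r y"
  using cub_eval_mult_diff[of r x y] by simp

lemma cub_poly_conj:
  "cub_poly (r\<^sup>2 - 2 :: 'a::comm_ring_1) = cub_poly r * (r ^ 3 - r\<^sup>2 - 2 * r + 1)"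
  by (simp add: cub_poly_def algebra_simps power2_eq_square power3_eq_cube)

lemma cub_eval_conj_diff:
  "cub_eval (r\<^sup>2 - 2) x - cub_eval r (cub_conj x) = cub_poly r * (of_int (cf2 x) * (r - 1))"
  by (simp add: cub_eval_def cub_poly_def algebra_simps power2_eq_square power3_eq_cube)

lemma cub_eval_conj:
  "cub_poly r = 0 \<Longrightarrow> cub_eval r (cub_conj x) = cub_eval (r\<^sup>2 - 2) x"
  using cub_eval_conj_diff[of r x] by simp

section \<open>Hurwitz quaternions over a commutative ring\<close>

text \<open>Coordinates with respect to \<open>1\<close>, \<open>(1+i+j+k)/2\<close>, \<open>i\<close>, \<open>(-1+i+j-k)/2\<close>; in this basis of the
  Hurwitz order the reduced norm is the quadratic form of the theorem.\<close>

datatype 'a hq = HQ (qa: 'a) (qb: 'a) (qc: 'a) (qd: 'a)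

lemma hq_eq_iff: "x = y \<longleftrightarrow> qa x = qa y \<and> qb x = qb y \<and> qc x = qc y \<and> qd x = qd y"
  by (cases x; cases y) simp

instantiation hq :: (comm_ring_1) ring_1
begin

definition "0 = HQ 0 0 0 0"
definition "1 = HQ 1 0 0 0"
definition "x + y = HQ (qa x + qa y) (qb x + qb y) (qc x + qc y) (qd x + qd y)"
definition "x - y = HQ (qa x - qa y) (qb x - qb y) (qc x - qc y) (qd x - qd y)"
definition "- x = HQ (- qa x) (- qb x) (- qc x) (- qd x)"
definition "x * y = HQ
  (qa x * qa y - qb x * qb y - qc x * qb y - qc x * qc y - qc x * qd y - qd x * qd y)
  (qa x * qb y + qb x * qa y + qb x * qb y + qc x * qd y - qd x * qb y - qd x * qc y)
  (qa x * qc y - qb x * qd y + qc x * qa y + qc x * qb y - qc x * qd y + qd x * qb y)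
  (qa x * qd y + qb x * qc y + qb x * qd y - qc x * qb y + qd x * qa y - qd x * qd y)"

instance
  by standard
    (auto simp: zero_hq_def one_hq_def plus_hq_def minus_hq_def uminus_hq_def times_hq_def
      algebra_simps)

end

lemma hq_sel [simp]:
  "qa 0 = 0" "qb 0 = 0" "qc 0 = 0" "qd 0 = 0"
  "qa 1 = 1" "qb 1 = 0" "qc 1 = 0" "qd 1 = 0"
  "qa (x + y) = qa x + qa y" "qb (x + y) = qb x + qb y"
  "qc (x + y) = qc x + qc y" "qd (x + y) = qd x + qd y"
  "qa (x - y) = qa x - qa y" "qb (x - y) = qb x - qb y"
  "qc (x - y) = qc x - qc y" "qd (x - y) = qd x - qd y"
  "qa (- x) = - qa x" "qb (- x) = - qb x" "qc (- x) = - qc x" "qd (- x) = - qd x"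
  by (simp_all add: zero_hq_def one_hq_def plus_hq_def minus_hq_def uminus_hq_def)

lemma hq_sel_times:
  "qa (x * y) = qa x * qa y - qb x * qb y - qc x * qb y - qc x * qc y - qc x * qd y - qd x * qd y"
  "qb (x * y) = qa x * qb y + qb x * qa y + qb x * qb y + qc x * qd y - qd x * qb y - qd x * qc y"
  "qc (x * y) = qa x * qc y - qb x * qd y + qc x * qa y + qc x * qb y - qc x * qd y + qd x * qb y"
  "qd (x * y) = qa x * qd y + qb x * qc y + qb x * qd y - qc x * qb y + qd x * qa y - qd x * qd y"
  by (simp_all add: times_hq_def)

definition hq_of :: "'a::comm_ring_1 \<Rightarrow> 'a hq" where
  "hq_of c = HQ c 0 0 0"

definition hq_conj :: "'a::comm_ring_1 hq \<Rightarrow> 'a hq" where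
  "hq_conj x = HQ (qa x + qb x - qd x) (- qb x) (- qc x) (- qd x)"

definition nrd :: "'a::comm_ring_1 hq \<Rightarrow> 'a" where
  "nrd x = (qa x)\<^sup>2 + qa x * qb x + (qb x)\<^sup>2 + qb x * qc x - qa x * qd x + (qc x)\<^sup>2
    + qc x * qd x + (qd x)\<^sup>2"

definition trd :: "'a::comm_ring_1 hq \<Rightarrow> 'a" where
  "trd x = 2 * qa x + qb x - qd x"

lemma hq_of_sel [simp]: "qa (hq_of c) = c" "qb (hq_of c) = 0" "qc (hq_of c) = 0" "qd (hq_of c) = 0"
  by (simp_all add: hq_of_def)

lemma hq_conj_sel [simp]:
  "qa (hq_conj x) = qa x + qb x - qd x" "qb (hq_conj x) = - qb x"
  "qc (hq_conj x) = - qc x" "qd (hq_conj x) = - qd x"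
  by (simp_all add: hq_conj_def)

lemma map_hq_sel [simp]:
  "qa (map_hq f x) = f (qa x)" "qb (map_hq f x) = f (qb x)"
  "qc (map_hq f x) = f (qc x)" "qd (map_hq f x) = f (qd x)"
  by (cases x; simp)+

lemma hq_of_hom:
  "hq_of (a + b) = hq_of a + hq_of b" "hq_of (a - b) = hq_of a - hq_of b"
  "hq_of (a * b) = hq_of a * hq_of b" "hq_of 0 = 0" "hq_of 1 = 1" "hq_of (- a) = - hq_of a"
  by (simp_all add: hq_eq_iff hq_sel_times)

lemma hq_of_eq_iff [simp]: "hq_of a = hq_of b \<longleftrightarrow> a = b"
  by (simp add: hq_eq_iff)

lemma hq_of_commute: "x * hq_of a = hq_of a * x"
  by (simp add: hq_eq_iff hq_sel_times algebra_simps)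

lemma hq_of_left_commute: "x * (hq_of a * y) = hq_of a * (x * y)"
  by (metis hq_of_commute mult.assoc)

lemma hq_of_mult_eq_0_iff:
  fixes a :: "'a::idom"
  shows "hq_of a * x = 0 \<longleftrightarrow> a = 0 \<or> x = 0"
  by (auto simp: hq_eq_iff hq_sel_times)

lemma hq_of_mult_cancel:
  fixes a :: "'a::idom"
  assumes "hq_of a * x = hq_of a * y" "a \<noteq> 0"
  shows "x = y"
proof -
  have "hq_of a * (x - y) = 0"
    using assms by (simp add: right_diff_distrib)
  then show ?thesis
    using assms by (simp add: hq_of_mult_eq_0_iff)
qed

lemma hq_conj_add: "hq_conj (x + y) = hq_conj x + hq_conj y"
  by (simp add: hq_eq_iff)

lemma hq_conj_diff: "hq_conj (x - y) = hq_conj x - hq_conj y"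
  by (simp add: hq_eq_iff)

lemma hq_conj_mult: "hq_conj (x * y) = hq_conj y * hq_conj x"
  by (simp add: hq_eq_iff hq_sel_times algebra_simps)

lemma hq_conj_conj [simp]: "hq_conj (hq_conj x) = x"
  by (simp add: hq_eq_iff)

lemma hq_conj_of [simp]: "hq_conj (hq_of c) = hq_of c"
  by (simp add: hq_eq_iff)

lemma hq_conj_0 [simp]: "hq_conj 0 = 0" and hq_conj_1 [simp]: "hq_conj 1 = 1"
  by (simp_all add: hq_eq_iff)

lemma mult_hq_conj: "x * hq_conj x = hq_of (nrd x)"
  by (simp add: hq_eq_iff hq_sel_times nrd_def algebra_simps power2_eq_square)

lemma hq_conj_mult_self: "hq_conj x * x = hq_of (nrd x)"
  by (simp add: hq_eq_iff hq_sel_times nrd_def algebra_simps power2_eq_square)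

lemma nrd_conj [simp]: "nrd (hq_conj x) = nrd x"
  by (simp add: nrd_def algebra_simps power2_eq_square)

lemma nrd_of [simp]: "nrd (hq_of c) = c\<^sup>2"
  by (simp add: nrd_def)

lemma nrd_mult: "nrd (x * y) = nrd x * nrd y"
proof -
  have "hq_of (nrd (x * y)) = (x * y) * hq_conj (x * y)"
    by (simp only: mult_hq_conj)
  also have "\<dots> = x * (y * hq_conj y) * hq_conj x"
    by (simp only: hq_conj_mult mult.assoc)
  also have "\<dots> = hq_of (nrd y) * (x * hq_conj x)"
    by (simp only: mult_hq_conj[of y] hq_of_commute[of x] mult.assoc)
  also have "\<dots> = hq_of (nrd x * nrd y)"
    by (simp only: mult_hq_conj hq_of_hom(3)[symmetric] mult.commute[of "nrd y"])
  finally show ?thesis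
    by simp
qed

lemma trd_eq: "hq_of (trd x) = x + hq_conj x"
  by (simp add: hq_eq_iff trd_def)

lemma trd_mult_commute: "trd (x * y) = trd (y * x)"
  by (simp add: trd_def hq_sel_times algebra_simps)

text \<open>The squared terms are the doubled coordinates with respect to 1, i, j, k.\<close>

lemma nrd_four_squares:
  "4 * nrd x = (2 * qa x + qb x - qd x)\<^sup>2 + (qb x + 2 * qc x + qd x)\<^sup>2 + (qb x + qd x)\<^sup>2 + (qb x - qd x)\<^sup>2"
  by (simp add: nrd_def algebra_simps power2_eq_square)

lemma nrd_nonneg: "nrd (x :: 'a::linordered_idom hq) \<ge> 0"
proof -
  have "4 * nrd x \<ge> 0"
    unfolding nrd_four_squares by simp
  then show ?thesis
    by (simp add: zero_le_mult_iff)
qed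

lemma nrd_eq_0:
  assumes "nrd (x :: 'a::linordered_idom hq) = 0"
  shows "x = 0"
proof -
  have "(2 * qa x + qb x - qd x)\<^sup>2 + (qb x + 2 * qc x + qd x)\<^sup>2 + (qb x + qd x)\<^sup>2 + (qb x - qd x)\<^sup>2 = 0"
    using nrd_four_squares[of x] assms by simp
  then have "2 * qa x + qb x - qd x = 0" "qb x + 2 * qc x + qd x = 0" "qb x + qd x = 0" "qb x - qd x = 0"
    by (simp_all add: add_nonneg_eq_0_iff)
  then show ?thesis
    by (simp add: hq_eq_iff)
qed

subsection \<open>Division with remainder\<close>

lemma int_nearest_multiple:
  fixes x a :: int
  assumes "a > 0"
  obtains m where "\<bar>x - 2 * a * m\<bar> \<le> a"
proof
  define m where "m = (x + a) div (2 * a)"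
  have "0 \<le> (x + a) mod (2 * a)" "(x + a) mod (2 * a) < 2 * a"
    using assms by simp_all
  moreover have "(x + a) mod (2 * a) = x + a - 2 * a * m"
    by (simp add: m_def minus_mult_div_eq_mod)
  ultimately show "\<bar>x - 2 * a * m\<bar> \<le> a"
    by linarith
qed

text \<open>Round x/a either to integer or to half-odd coordinates in 1, i, j, k. A residue R
  becomes a - |R| in absolute value, so the two sums of squares add up to at most 4 a^2 and one of
  them is at most 2 a^2.\<close>

lemma hq_division:
  fixes x :: "int hq" and a :: int
  assumes a: "a > 0"
  obtains q where "2 * nrd (x - hq_of a * q) \<le> a\<^sup>2"
proof -
  define X1 X2 X3 X4 where X: "X1 = 2 * qa x + qb x - qd x" "X2 = qb x + 2 * qc x + qd x"
    "X3 = qb x + qd x" "X4 = qb x - qd x"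
  obtain m1 m2 m3 m4 where m: "\<bar>X1 - 2 * a * m1\<bar> \<le> a" "\<bar>X2 - 2 * a * m2\<bar> \<le> a"
    "\<bar>X3 - 2 * a * m3\<bar> \<le> a" "\<bar>X4 - 2 * a * m4\<bar> \<le> a"
    using int_nearest_multiple[OF a] by metis
  define R1 R2 R3 R4 where R: "R1 = X1 - 2 * a * m1" "R2 = X2 - 2 * a * m2"
    "R3 = X3 - 2 * a * m3" "R4 = X4 - 2 * a * m4"
  show thesis
  proof (cases "R1\<^sup>2 + R2\<^sup>2 + R3\<^sup>2 + R4\<^sup>2 \<le> 2 * a\<^sup>2")
    case True
    \<comment> \<open>This is m1 + m2 i + m3 j + m4 k.\<close>
    define q where "q = HQ (m1 - m4) (m3 + m4) (m2 - m3) (m3 - m4)"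
    have "4 * nrd (x - hq_of a * q) = R1\<^sup>2 + R2\<^sup>2 + R3\<^sup>2 + R4\<^sup>2"
      unfolding nrd_four_squares R X by (simp add: q_def hq_sel_times algebra_simps)
    with True show thesis
      by (intro that[of q]) linarith
  next
    case False
    define s where "s R = (if R \<ge> 0 then 0 else -1 :: int)" for R :: int
    define s1 s2 s3 s4 where ss: "s1 = s R1" "s2 = s R2" "s3 = s R3" "s4 = s R4"
    \<comment> \<open>The quaternion with coordinates m + s + 1/2, where s selects the half-odd
      number on the side of the residue.\<close>
    define q where "q = HQ (m1 + s1 - (m4 + s4)) (m3 + s3 + (m4 + s4) + 1)
      (m2 + s2 - (m3 + s3)) (m3 + s3 - (m4 + s4))"
    have sq: "(R - (2 * s R + 1) * a)\<^sup>2 \<le> a\<^sup>2 - R\<^sup>2" if "\<bar>R\<bar> \<le> a" for R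
    proof (cases "R \<ge> 0")
      case True
      then have "R * (a - R) \<ge> 0"
        using that by simp
      then show ?thesis
        using True by (simp add: s_def power2_eq_square algebra_simps)
    next
      case False
      then have "(- R) * (a + R) \<ge> 0"
        using that by (intro mult_nonneg_nonneg) auto
      then show ?thesis
        using False by (simp add: s_def power2_eq_square algebra_simps)
    qed
    have "4 * nrd (x - hq_of a * q) = (R1 - (2 * s1 + 1) * a)\<^sup>2 + (R2 - (2 * s2 + 1) * a)\<^sup>2
      + (R3 - (2 * s3 + 1) * a)\<^sup>2 + (R4 - (2 * s4 + 1) * a)\<^sup>2"
      unfolding nrd_four_squares R X by (simp add: q_def hq_sel_times algebra_simps)
    also have "\<dots> \<le> 4 * a\<^sup>2 - (R1\<^sup>2 + R2\<^sup>2 + R3\<^sup>2 + R4\<^sup>2)"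
      using sq[of R1] sq[of R2] sq[of R3] sq[of R4] m unfolding ss R by simp
    finally show thesis
      using False by (intro that[of q]) linarith
  qed
qed

subsection \<open>Positive integers are reduced norms\<close>

text \<open>Pigeonhole: on the half range the maps x^2 and -1 - y^2 are injective modulo p, and each
  takes (p + 1)/2 values.\<close>

lemma prime_dvd_one_plus_two_squares:
  fixes p :: int
  assumes p: "prime p" "odd p"
  obtains x y where "0 \<le> x" "2 * x < p" "0 \<le> y" "2 * y < p" "p dvd 1 + x\<^sup>2 + y\<^sup>2"
proof -
  define S where "S = {x :: int. 0 \<le> x \<and> 2 * x < p}"
  define f where "f x = x\<^sup>2 mod p" for x
  define g where "g y = (- 1 - y\<^sup>2) mod p" for y
  have p0: "p > 2"
    using p prime_ge_2_int[of p] by (cases "p = 2") auto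
  have S: "S = {0..(p - 1) div 2}"
    using p0 by (auto simp: S_def)
  have fin: "finite S" and card: "2 * int (card S) > p"
    using p0 unfolding S by (auto simp: \<open>odd p\<close>)
  have sq: "x = y" if "x \<in> S" "y \<in> S" "p dvd x\<^sup>2 - y\<^sup>2" for x y
  proof -
    have "p dvd (x - y) * (x + y)"
      using that(3) by (simp add: algebra_simps power2_eq_square)
    then have "p dvd x - y \<or> p dvd x + y"
      using p prime_dvd_mult_iff by blast
    moreover have "\<bar>x - y\<bar> < p" "0 \<le> x + y" "x + y < p"
      using that by (auto simp: S_def)
    ultimately have "x - y = 0 \<or> x + y = 0"
      using zdvd_imp_le[of p "x + y"] dvd_imp_le_int[of "x - y" p] by fastforce
    with that show ?thesis
      by (auto simp: S_def)
  qed
  have inj_f: "inj_on f S"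
    by (rule inj_onI, rule sq) (auto simp: f_def mod_eq_dvd_iff)
  have inj_g: "inj_on g S"
  proof (rule inj_onI)
    fix x y assume xy: "x \<in> S" "y \<in> S" "g x = g y"
    then have "p dvd (- 1 - x\<^sup>2) - (- 1 - y\<^sup>2)"
      by (simp add: g_def mod_eq_dvd_iff)
    then have "p dvd y\<^sup>2 - x\<^sup>2"
      by simp
    then show "x = y"
      using sq[of y x] xy by simp
  qed
  have "f ` S \<inter> g ` S \<noteq> {}"
  proof
    assume "f ` S \<inter> g ` S = {}"
    then have "card (f ` S \<union> g ` S) = 2 * card S"
      using fin by (simp add: card_Un_disjoint card_image inj_f inj_g)
    moreover have "f ` S \<union> g ` S \<subseteq> {0..<p}"
      using p0 by (auto simp: f_def g_def)
    then have "card (f ` S \<union> g ` S) \<le> card {0..<p}"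
      by (intro card_mono) auto
    ultimately show False
      using card p0 by simp
  qed
  then obtain x y where xy: "x \<in> S" "y \<in> S" "f x = g y"
    by auto
  then have "p dvd x\<^sup>2 - (- 1 - y\<^sup>2)"
    by (simp add: f_def g_def mod_eq_dvd_iff)
  then have "p dvd 1 + x\<^sup>2 + y\<^sup>2"
    by (simp add: algebra_simps)
  with xy show thesis
    by (intro that[of x y]) (auto simp: S_def)
qed

text \<open>Lagrange's descent. Take the least m > 0 such that m p is a reduced norm. Division by m
  leaves a remainder of norm m k with k at most m/2, so a nonzero remainder would make k p a reduced
  norm.\<close>

lemma prime_is_nrd:
  fixes p :: int
  assumes p: "prime p"
  shows "\<exists>x :: int hq. nrd x = p"
proof (cases "odd p")
  case False
  then have "p = 2"
    using p by (metis primes_dvd_imp_eq two_is_prime_nat prime_nat_int_transfer dvd_refl even_iff_mod_2_eq_zero of_nat_numeral prime_int_numeral_eq)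
  then have "nrd (HQ 1 0 1 0) = p"
    by (simp add: nrd_def)
  then show ?thesis
    by blast
next
  case True
  have p0: "p > 1"
    using p by (simp add: prime_gt_1_int)
  obtain x y where xy: "0 \<le> x" "2 * x < p" "0 \<le> y" "2 * y < p" "p dvd 1 + x\<^sup>2 + y\<^sup>2"
    using prime_dvd_one_plus_two_squares[OF p True] by metis
  define P where "P m \<longleftrightarrow> m > 0 \<and> (\<exists>a :: int hq. nrd a = int m * p)" for m
  obtain m0 where m0: "1 + x\<^sup>2 + y\<^sup>2 = p * m0"
    using xy(5) by blast
  have "2 * x * (2 * x) \<le> (p - 1) * (p - 1)" "2 * y * (2 * y) \<le> (p - 1) * (p - 1)"
    using xy p0 by (intro mult_mono; linarith)+
  then have "4 * (p * m0) \<le> 4 + 2 * ((p - 1) * (p - 1))"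
    unfolding m0[symmetric] by (simp add: power2_eq_square algebra_simps)
  also have "\<dots> < 4 * (p * p)"
    using p0 mult_strict_mono[of 1 p 1 p] by (simp add: algebra_simps)
  finally have "m0 < p"
    using p0 by simp
  have "m0 > 0"
  proof (rule ccontr)
    assume "\<not> m0 > 0"
    then have "p * m0 \<le> 0"
      using p0 by (simp add: mult_nonneg_nonpos)
    with m0 show False
      using zero_le_power2[of x] zero_le_power2[of y] by linarith
  qed
  \<comment> \<open>The quaternion 1 + x i + y j.\<close>
  have "nrd (HQ 1 y (x - y) y) = 1 + x\<^sup>2 + y\<^sup>2"
    by (simp add: nrd_def power2_eq_square algebra_simps)
  then have P0: "P (nat m0)"
    unfolding P_def using \<open>m0 > 0\<close> m0 by (auto intro!: exI[of _ "HQ 1 y (x - y) y"] simp: mult.commute)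
  define m where "m = (LEAST m. P m)"
  have Pm: "P m" and least: "\<And>k. P k \<Longrightarrow> m \<le> k"
    unfolding m_def using P0 by (auto intro: LeastI Least_le)
  then obtain a :: "int hq" where a: "nrd a = int m * p" and "m > 0"
    by (auto simp: P_def)
  obtain q where q: "2 * nrd (a - hq_of (int m) * q) \<le> (int m)\<^sup>2"
    using hq_division[of "int m" a] \<open>m > 0\<close> by auto
  define b where "b = a - hq_of (int m) * q"
  have ab: "a = b + hq_of (int m) * q"
    by (simp add: b_def)
  \<comment> \<open>This is \<open>b * hq_conj a\<close> divided by m, written without
    division.\<close>
  define c where "c = hq_of p - q * hq_conj a"
  have "hq_of (int m) * c = hq_of (int m * p) - hq_of (int m) * (q * hq_conj a)"
    by (simp add: c_def right_diff_distrib hq_of_hom)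
  also have "\<dots> = b * hq_conj a"
    using mult_hq_conj[of a] by (simp add: a b_def algebra_simps)
  finally have c: "hq_of (int m) * c = b * hq_conj a" .
  have "int m * int m * nrd c = nrd (hq_of (int m) * c)"
    by (simp add: nrd_mult power2_eq_square)
  also have "\<dots> = nrd b * (int m * p)"
    by (simp add: c nrd_mult a)
  finally have nc: "int m * nrd c = nrd b * p"
    using \<open>m > 0\<close> by simp
  show ?thesis
  proof (cases "nrd b = 0")
    case True
    then have "a = hq_of (int m) * q"
      using nrd_eq_0[of b] by (simp add: b_def)
    then have "int m * p = int m * (int m * nrd q)"
      using a by (auto simp: nrd_mult power2_eq_square)
    then have *: "p = int m * nrd q"
      using \<open>m > 0\<close> by auto
    have "int m < p"
      using least[OF P0] \<open>m0 < p\<close> \<open>m0 > 0\<close> by linarith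
    then have "int m = 1"
      using * p \<open>m > 0\<close> by (metis dvdI prime_int_iff of_nat_0_le_iff order_less_irrefl)
    then show ?thesis
      using a by auto
  next
    case False
    have "int m dvd nrd b * p"
      using nc by (metis dvd_triv_left)
    moreover have "coprime (int m) p"
    proof -
      have "int m < p"
        using least[OF P0] \<open>m0 < p\<close> \<open>m0 > 0\<close> by linarith
      then have "\<not> p dvd int m"
        using \<open>m > 0\<close> zdvd_imp_le by fastforce
      then show ?thesis
        using p prime_imp_coprime coprime_commute by blast
    qed
    ultimately have "int m dvd nrd b"
      by (simp add: coprime_dvd_mult_left_iff)
    then obtain k where k: "nrd b = int m * k"
      by blast
    have kp: "k > 0"
      using False nrd_nonneg[of b] k \<open>m > 0\<close>
      by (metis less_le mult_eq_0_iff of_nat_0_less_iff zero_less_mult_pos)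
    have "nrd c = k * p"
      using nc k \<open>m > 0\<close> by simp
    then have "P (nat k)"
      using kp unfolding P_def by auto
    then have "int m \<le> k"
      using least[of "nat k"] kp by linarith
    then have "2 * (int m * int m) \<le> 2 * (int m * k)"
      using \<open>m > 0\<close> by simp
    also have "\<dots> \<le> int m * int m"
      using q k by (simp add: b_def power2_eq_square)
    finally show ?thesis
      using \<open>m > 0\<close> by simp
  qed
qed

theorem pos_int_is_nrd:
  fixes n :: int
  assumes "n > 0"
  shows "\<exists>x :: int hq. nrd x = n"
proof -
  have "n \<noteq> 0 \<longrightarrow> n \<ge> 0 \<longrightarrow> (\<exists>x :: int hq. nrd x = n)"
  proof (induction n rule: prime_divisors_induct)
    case (unit x)
    then show ?case
      by (auto intro!: exI[of _ "1 :: int hq"] simp: nrd_def)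
  next
    case (factor p x)
    show ?case
    proof (intro impI)
      assume "p * x \<noteq> 0" "0 \<le> p * x"
      then have "x \<noteq> 0" "x \<ge> 0"
        using prime_gt_0_int[OF factor.hyps] by (auto simp: zero_le_mult_iff)
      then obtain u v :: "int hq" where "nrd u = x" "nrd v = p"
        using factor.IH prime_is_nrd[OF factor.hyps] by blast
      then have "nrd (v * u) = p * x"
        by (simp add: nrd_mult)
      then show "\<exists>x' :: int hq. nrd x' = p * x"
        by blast
    qed
  qed simp
  with assms show ?thesis
    by simp
qed

section \<open>Reduction of Hermitian lattices of rank three\<close>

lemma nrd_diff:
  "nrd (x - y) = nrd x + nrd y - trd (x * hq_conj y)"
  by (simp add: nrd_def trd_def hq_sel_times algebra_simps power2_eq_square)

lemma trd_hq_of_mult: "trd (hq_of a * x) = a * trd x"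
  by (simp add: trd_def hq_sel_times algebra_simps)

lemma trd_conj [simp]: "trd (hq_conj x) = trd x"
  by (simp add: trd_def)

text \<open>The form is only semidefinite: the pairs used later represent lattice elements
  non-uniquely, and \<open>h_null\<close> makes the null vectors harmless.
  \<open>rank_one_mod_7\<close> makes the 2 x 2 Gram determinants vanish modulo 7.\<close>

locale hermitian_lattice =
  fixes act :: "int hq \<Rightarrow> 'v::ab_group_add \<Rightarrow> 'v"
    and h :: "'v \<Rightarrow> 'v \<Rightarrow> int hq"
    and n :: "'v \<Rightarrow> int"
  assumes h_diff: "h (u - v) w = h u w - h v w"
    and h_act: "h (act q u) w = q * h u w"
    and h_conj: "hq_conj (h u v) = h v u"
    and h_self: "h u u = hq_of (n u)"
    and n_nonneg: "n u \<ge> 0"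
    and h_null: "n u = 0 \<Longrightarrow> h u v = 0"
    and rank_one_mod_7: "7 dvd n u * n v - nrd (h u v)"
begin

definition gram2 :: "'v \<Rightarrow> 'v \<Rightarrow> int" where
  "gram2 u v = n u * n v - nrd (h u v)"

text \<open>The (Moore) determinant of the Gram matrix.\<close>

definition gram3 :: "'v \<Rightarrow> 'v \<Rightarrow> 'v \<Rightarrow> int" where
  "gram3 u v w = n u * n v * n w + trd (h u v * h v w * h w u)
     - n u * nrd (h v w) - n v * nrd (h u w) - n w * nrd (h u v)"

text \<open>\<open>n u\<close> times the product of the projections of w and v to the orthogonal
  complement of u.\<close>

definition off :: "'v \<Rightarrow> 'v \<Rightarrow> 'v \<Rightarrow> int hq" where
  "off u v w = hq_of (n u) * h w v - h w u * h u v"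

lemma h_diff_right: "h w (u - v) = h w u - h w v"
  by (metis h_conj h_diff hq_conj_diff)

lemma h_act_right: "h w (act q u) = h w u * hq_conj q"
  by (metis h_conj h_act hq_conj_mult)

lemma nrd_h_commute: "nrd (h u v) = nrd (h v u)"
  by (metis h_conj nrd_conj)

lemma n_diff_act: "n (v - act q u) = n v + nrd q * n u - trd (q * h u v)"
proof -
  have "hq_of (n (v - act q u)) = h (v - act q u) (v - act q u)"
    by (simp add: h_self)
  also have "\<dots> = hq_of (n v) + q * hq_of (n u) * hq_conj q - (q * h u v + hq_conj (q * h u v))"
    by (simp only: h_diff h_diff_right h_act h_act_right hq_conj_mult h_conj) (simp add: h_self algebra_simps)
  also have "q * hq_of (n u) * hq_conj q = hq_of (nrd q * n u)"
    by (simp only: hq_of_commute[of q] mult.assoc mult_hq_conj hq_of_hom(3)[symmetric] mult.commute[of "n u"])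
  also have "hq_of (n v) + hq_of (nrd q * n u) - (q * h u v + hq_conj (q * h u v)) =
      hq_of (n v + nrd q * n u - trd (q * h u v))"
    by (simp only: trd_eq[symmetric] hq_of_hom(1,2)[symmetric])
  finally show ?thesis
    by simp
qed

lemma h_diff_act: "h u (v - act q u) = h u v - hq_of (n u) * hq_conj q"
  by (simp add: h_diff_right h_act_right h_self)

lemma gram2_diff_act: "gram2 u (v - act q u) = gram2 u v"
proof -
  have "nrd (h u v - hq_of (n u) * hq_conj q) =
      nrd (h u v) + (n u)\<^sup>2 * nrd q - n u * trd (q * h u v)"
    by (simp add: nrd_diff nrd_mult hq_conj_mult hq_of_left_commute hq_of_commute[of q] trd_hq_of_mult trd_mult_commute[of "h u v"] mult.assoc)
  then show ?thesis
    by (simp add: gram2_def n_diff_act h_diff_act algebra_simps power2_eq_square)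
qed

text \<open>Cauchy-Schwarz: the vector n(u) v - h(v,u) u has norm
  \<open>n u * gram2 u v\<close>.\<close>

lemma gram2_nonneg: "gram2 u v \<ge> 0"
proof (cases "n u = 0")
  case True
  then show ?thesis
    by (simp add: gram2_def h_null nrd_def)
next
  case False
  define a where "a = n u"
  define w where "w = act (hq_of a) v - act (h v u) u"
  have "hq_of (n (act (hq_of a) v)) = hq_of a * (hq_of (n v) * hq_of a)"
    by (simp only: h_self[symmetric] h_act h_act_right hq_conj_of mult.assoc)
  also have "\<dots> = hq_of (a * (n v * a))"
    by (simp only: hq_of_hom)
  finally have 1: "n (act (hq_of a) v) = a * (n v * a)"
    by simp
  have "h v u * h u (act (hq_of a) v) = h v u * h u v * hq_of a"
    by (simp only: h_act_right hq_conj_of mult.assoc)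
  also have "h v u * h u v = hq_of (nrd (h u v))"
    by (simp add: h_conj[of u v, symmetric] hq_conj_mult_self)
  also have "\<dots> * hq_of a = hq_of (nrd (h u v) * a)"
    by (simp only: hq_of_hom)
  finally have 2: "trd (h v u * h u (act (hq_of a) v)) = 2 * (nrd (h u v) * a)"
    by (simp add: trd_def)
  have "n w = n u * gram2 u v"
    unfolding w_def n_diff_act 1 2 gram2_def nrd_h_commute[of v u]
    by (simp add: a_def algebra_simps)
  then show ?thesis
    using n_nonneg[of w] n_nonneg[of u] False by (simp add: zero_le_mult_iff)
qed

lemma gram3_swap12: "gram3 u v w = gram3 v u w"
proof -
  have "trd (h u v * h v w * h w u) = trd (hq_conj (h u v * h v w * h w u))"
    by simp
  also have "\<dots> = trd (h u w * (h w v * h v u))"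
    by (simp only: hq_conj_mult h_conj)
  also have "\<dots> = trd (h w v * h v u * h u w)"
    by (rule trd_mult_commute)
  also have "\<dots> = trd (h v u * h u w * h w v)"
    using trd_mult_commute[of "h w v" "h v u * h u w"] by (simp add: mult.assoc)
  finally show ?thesis
    by (simp add: gram3_def nrd_h_commute[of u v])
qed

lemma gram3_rotate: "gram3 u v w = gram3 v w u"
  using trd_mult_commute[of "h u v" "h v w * h w u"]
  by (simp add: gram3_def mult.assoc nrd_h_commute[of w u] nrd_h_commute[of v u])

lemma gram3_swap23: "gram3 u v w = gram3 u w v"
  by (metis gram3_rotate gram3_swap12)

text \<open>Jacobi's identity for minors. It reduces statements on the noncommutative 3 x 3
  determinant to \<open>gram2\<close> and \<open>off\<close>.\<close>

lemma gram3_expand: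
  "n u * gram3 u v w = gram2 u v * gram2 u w - nrd (off u v w)"
proof -
  have "nrd (off u v w) = (n u)\<^sup>2 * nrd (h w v) + nrd (h w u) * nrd (h u v)
      - n u * trd (h w v * (hq_conj (h u v) * hq_conj (h w u)))"
    by (simp add: off_def nrd_diff nrd_mult hq_conj_mult trd_hq_of_mult mult.assoc)
  also have "trd (h w v * (hq_conj (h u v) * hq_conj (h w u))) = trd (h u v * h v w * h w u)"
  proof -
    have "trd (h u v * h v w * h w u) = trd (hq_conj (h u v * h v w * h w u))"
      by simp
    also have "\<dots> = trd (h u w * (h w v * h v u))"
      by (simp only: hq_conj_mult h_conj)
    also have "\<dots> = trd (h w v * h v u * h u w)"
      by (rule trd_mult_commute)
    finally show ?thesis
      by (simp add: h_conj mult.assoc)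
  qed
  finally show ?thesis
    by (simp add: gram3_def gram2_def nrd_h_commute[of w] algebra_simps power2_eq_square)
qed

lemma off_diff_act_1: "off u (v - act q u) w = off u v w"
  by (simp add: off_def h_self h_diff_right h_act_right right_diff_distrib hq_of_left_commute)

text \<open>Changing w by multiples of v moves \<open>off\<close> by multiples of
  \<open>gram2 u v\<close>, which permits a second division with remainder.\<close>

lemma off_diff_act_2:
  "off u v (w - act q v) = off u v w - hq_of (gram2 u v) * q"
proof -
  have "off u v (w - act q v) = off u v w - (hq_of (n u) * (q * hq_of (n v)) - q * (h v u * h u v))"
    by (simp add: off_def h_diff h_act h_self algebra_simps)
  also have "h v u * h u v = hq_of (nrd (h u v))"
    by (simp add: h_conj[of u v, symmetric] hq_conj_mult_self)
  also have "hq_of (n u) * (q * hq_of (n v)) - q * hq_of (nrd (h u v)) = hq_of (gram2 u v) * q"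
    by (simp add: gram2_def hq_of_hom hq_of_commute[of q] left_diff_distrib mult.assoc)
  finally show ?thesis .
qed

lemma gram3_diff_act:
  assumes "n u > 0"
  shows "gram3 u (v - act q u) w = gram3 u v w"
proof -
  have "n u * gram3 u (v - act q u) w = n u * gram3 u v w"
    by (simp add: gram3_expand gram2_diff_act off_diff_act_1)
  with assms show ?thesis
    by simp
qed

text \<open>A triple whose first two members minimise lexicographically the norm and the 2 x 2 Gram
  determinant satisfies Hermite's inequalities; the congruence modulo 7 excludes
  the one remaining value 7 of the minimum.\<close>

theorem exists_short_vector:
  assumes "gram3 u\<^sub>0 v\<^sub>0 w\<^sub>0 = 49"
  shows "\<exists>u. 0 < n u \<and> n u \<le> 6"
proof -
  have n_pos: "n u > 0" if "gram3 u v w = 49" for u v w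
  proof (rule ccontr)
    assume "\<not> n u > 0"
    then have "n u = 0"
      using n_nonneg[of u] by simp
    moreover have "h w u = 0"
      using h_null[OF calculation, of w] h_conj[of u w] by simp
    ultimately have "gram3 u v w = 0"
      by (simp add: gram3_def h_null nrd_def trd_def)
    with that show False
      by simp
  qed
  define P where "P = (\<lambda>(u, v, w). gram3 u v w = 49)"
  define R :: "(('v \<times> 'v \<times> 'v) \<times> ('v \<times> 'v \<times> 'v)) set" where
    "R = measures [\<lambda>(u, v, w). nat (n u), \<lambda>(u, v, w). nat (gram2 u v)]"
  have "wf R"
    by (simp add: R_def)
  moreover have "(u\<^sub>0, v\<^sub>0, w\<^sub>0) \<in> Collect P"
    using assms by (simp add: P_def)
  ultimately obtain t where t: "t \<in> Collect P" "\<And>s. (s, t) \<in> R \<Longrightarrow> s \<notin> Collect P"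
    using wfE_min[of R _ "Collect P"] by blast
  obtain u v w where tuvw: "t = (u, v, w)"
    by (cases t) auto
  have D: "gram3 u v w = 49"
    using t(1) by (simp add: P_def tuvw)
  have min1: "n u \<le> n u'" if "gram3 u' v' w' = 49" for u' v' w'
  proof (rule ccontr)
    assume "\<not> n u \<le> n u'"
    then have "((u', v', w'), t) \<in> R"
      using n_nonneg[of u'] by (simp add: R_def tuvw)
    then show False
      using t(2) that by (auto simp: P_def)
  qed
  have min2: "gram2 u v \<le> gram2 u v'" if "gram3 u v' w' = 49" for v' w'
  proof (rule ccontr)
    assume "\<not> gram2 u v \<le> gram2 u v'"
    then have "((u, v', w'), t) \<in> R"
      using gram2_nonneg[of u v'] by (simp add: R_def tuvw)
    then show False
      using t(2) that by (auto simp: P_def)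
  qed
  define a where "a = n u"
  define g where "g = gram2 u v"
  have a: "a > 0"
    using n_pos[OF D] by (simp add: a_def)
  \<comment> \<open>Reducing v by u makes nrd (h u v') at most a^2/2. The triple (v', u, w) also has
    determinant 49, so n v' is at least a, and g >= a^2 - a^2/2.\<close>
  obtain q where q: "2 * nrd (hq_conj (h u v) - hq_of a * q) \<le> a\<^sup>2"
    using hq_division[OF a] .
  define v' where "v' = v - act q u"
  have D': "gram3 u v' w = 49"
    using a D by (simp add: v'_def gram3_diff_act a_def)
  have "nrd (h u v') = nrd (hq_conj (h u v'))"
    by simp
  also have "hq_conj (h u v') = hq_conj (h u v) - hq_of a * q"
    by (simp add: v'_def h_diff_act hq_conj_diff hq_conj_mult hq_of_commute a_def)
  finally have "2 * nrd (h u v') \<le> a\<^sup>2"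
    using q by simp
  moreover have "a \<le> n v'"
    using min1[of v' u w] D' gram3_swap12[of u v' w] by (simp add: a_def)
  then have "a\<^sup>2 \<le> a * n v'"
    using a by (simp add: power2_eq_square)
  moreover have "g = a * n v' - nrd (h u v')"
    using gram2_diff_act[of u v q] by (simp add: g_def v'_def a_def gram2_def)
  ultimately have g: "a\<^sup>2 \<le> 2 * g"
    by linarith
  then have "g > 0"
    using a by (smt (verit) zero_less_power)
  \<comment> \<open>The same orthogonally to u: minimality gives gram2 u w' >= g, and
    \<open>gram3_expand\<close> yields 49 a >= g^2 - g^2/2.\<close>
  obtain r where r: "2 * nrd (off u v w - hq_of g * r) \<le> g\<^sup>2"
    using hq_division[OF \<open>g > 0\<close>] .
  define w' where "w' = w - act r v"
  have "n v > 0"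
    using n_pos[of v u w] D gram3_swap12[of u v w] by simp
  then have D2: "gram3 u v w' = 49"
    using D gram3_diff_act[of v w r u] by (simp add: w'_def gram3_rotate[of u])
  have "off u v w' = off u v w - hq_of g * r"
    by (simp add: w'_def off_diff_act_2 g_def)
  then have "2 * nrd (off u v w') \<le> g\<^sup>2"
    using r by simp
  moreover have "g \<le> gram2 u w'"
    using min2[of w' v] D2 gram3_swap23[of u v w'] by (simp add: g_def)
  then have "g\<^sup>2 \<le> g * gram2 u w'"
    using \<open>g > 0\<close> by (simp add: power2_eq_square)
  moreover have "a * 49 = g * gram2 u w' - nrd (off u v w')"
    using gram3_expand[of u v w'] D2 by (simp add: a_def g_def)
  ultimately have ag: "g\<^sup>2 \<le> 98 * a"
    by linarith
  have "a \<le> 6"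
  proof (rule ccontr)
    assume "\<not> a \<le> 6"
    \<comment> \<open>Combined: a^4 <= 4 g^2 <= 392 a, hence a^3 <= 392 < 8^3.\<close>
    have "(a\<^sup>2)\<^sup>2 \<le> (2 * g)\<^sup>2"
      using g by (intro power_mono) auto
    then have "a * a ^ 3 \<le> a * 392"
      using ag by (simp add: power2_eq_square power3_eq_cube)
    then have "a ^ 3 \<le> 392"
      using a by (simp only: mult_le_cancel_left_pos)
    then have "a < 8"
      using power_mono[of 8 a 3] by (cases "a < 8") auto
    with \<open>\<not> a \<le> 6\<close> have "a = 7"
      by simp
    then have "25 \<le> g"
      using g by simp
    \<comment> \<open>For a = 7 the inequalities leave only g = 25 and g = 26, neither a multiple of
      7.\<close>
    moreover have "7 dvd g"
      using rank_one_mod_7[of u v] by (simp add: g_def gram2_def)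
    ultimately have "28 \<le> g"
      by (auto elim!: dvdE)
    then have "28 * 28 \<le> g\<^sup>2"
      using mult_mono[of 28 g 28 g] by (simp add: power2_eq_square)
    with ag \<open>a = 7\<close> show False
      by simp
  qed
  with a show ?thesis
    unfolding a_def by blast
qed

end

section \<open>Real conjugates and total positivity\<close>

lemma cub_poly_root_conj: "cub_poly r = 0 \<Longrightarrow> cub_poly (r\<^sup>2 - 2 :: 'a::comm_ring_1) = 0"
  by (simp add: cub_poly_conj)

lemma cub_eval_trace:
  assumes "cub_poly (r::'a::comm_ring_1) = 0"
  shows "of_int (cub_trace x) = cub_eval r x + cub_eval (r\<^sup>2 - 2) x + cub_eval ((r\<^sup>2 - 2)\<^sup>2 - 2) x"
  using arg_cong[OF cub_trace_conj[of x], of "cub_eval r"] assms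
  by (simp add: cub_eval_add cub_eval_conj cub_poly_root_conj)

lemma cub_eval_norm:
  assumes "cub_poly (r::'a::comm_ring_1) = 0"
  shows "of_int (cub_norm x) = cub_eval r x * cub_eval (r\<^sup>2 - 2) x * cub_eval ((r\<^sup>2 - 2)\<^sup>2 - 2) x"
  using arg_cong[OF cub_norm_conj[of x], of "cub_eval r"] assms
  by (simp add: cub_eval_mult cub_eval_conj cub_poly_root_conj)

lemma cub_eval_pairs:
  assumes "cub_poly (r::'a::comm_ring_1) = 0"
  shows "of_int (cub_pairs x) = cub_eval r x * cub_eval (r\<^sup>2 - 2) x
    + cub_eval r x * cub_eval ((r\<^sup>2 - 2)\<^sup>2 - 2) x + cub_eval (r\<^sup>2 - 2) x * cub_eval ((r\<^sup>2 - 2)\<^sup>2 - 2) x"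
  using arg_cong[OF cub_pairs_conj[of x], of "cub_eval r"] assms
  by (simp add: cub_eval_add cub_eval_mult cub_eval_conj cub_poly_root_conj)

lemma cub_poly_root_exists: "\<exists>r::real. cub_poly r = 0"
proof -
  have "\<exists>r. 1 \<le> r \<and> r \<le> 2 \<and> cub_poly r = (0::real)"
    unfolding cub_poly_def by (intro IVT') (auto intro!: continuous_intros)
  then show ?thesis
    by blast
qed

lemma cub_eval_eq_0_iff:
  assumes "cub_poly (r::'a::{comm_ring_1,ring_char_0}) = 0"
  shows "cub_eval r x = 0 \<longleftrightarrow> x = 0"
  using cub_eval_norm[OF assms, of x] by auto

definition cub_totpos :: "cub \<Rightarrow> bool" where
  "cub_totpos x \<longleftrightarrow> (\<forall>r::real. cub_poly r = 0 \<longrightarrow> cub_eval r x > 0)"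

lemma cub_totpos_imp:
  assumes "cub_totpos x"
  shows "cub_trace x > 0" "cub_pairs x > 0" "cub_norm x > 0"
proof -
  obtain r :: real where r: "cub_poly r = 0"
    using cub_poly_root_exists by blast
  define a b c where "a = cub_eval r x" "b = cub_eval (r\<^sup>2 - 2) x" "c = cub_eval ((r\<^sup>2 - 2)\<^sup>2 - 2) x"
  have abc: "a > 0" "b > 0" "c > 0"
    using assms r by (auto simp: cub_totpos_def a_b_c_def cub_poly_root_conj)
  have "real_of_int (cub_trace x) > 0" "real_of_int (cub_pairs x) > 0" "real_of_int (cub_norm x) > 0"
    unfolding cub_eval_trace[OF r] cub_eval_norm[OF r] cub_eval_pairs[OF r] a_b_c_def[symmetric]
    using abc by (auto intro!: add_pos_pos)
  then show "cub_trace x > 0" "cub_pairs x > 0" "cub_norm x > 0"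
    by simp_all
qed

section \<open>The Hermitian lattice of a divisor of \<open>\<rho> - r\<close>\<close>

definition hq_int :: "int hq \<Rightarrow> cub hq" where
  "hq_int = map_hq of_int"

lemma hq_int_sel [simp]:
  "qa (hq_int x) = of_int (qa x)" "qb (hq_int x) = of_int (qb x)"
  "qc (hq_int x) = of_int (qc x)" "qd (hq_int x) = of_int (qd x)"
  by (simp_all add: hq_int_def)

lemma hq_int_hom:
  "hq_int (x + y) = hq_int x + hq_int y" "hq_int (x - y) = hq_int x - hq_int y"
  "hq_int (x * y) = hq_int x * hq_int y" "hq_int 0 = 0" "hq_int 1 = 1"
  "hq_int (hq_conj x) = hq_conj (hq_int x)" "hq_int (hq_of k) = hq_of (of_int k)"
  by (simp_all add: hq_eq_iff hq_sel_times)

lemma nrd_hq_int: "nrd (hq_int x) = of_int (nrd x)"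
  by (simp add: nrd_def)

definition hq_trace :: "cub hq \<Rightarrow> int hq" where
  "hq_trace = map_hq cub_trace"

lemma hq_trace_sel [simp]:
  "qa (hq_trace x) = cub_trace (qa x)" "qb (hq_trace x) = cub_trace (qb x)"
  "qc (hq_trace x) = cub_trace (qc x)" "qd (hq_trace x) = cub_trace (qd x)"
  by (simp_all add: hq_trace_def)

lemma cub_trace_linear:
  "cub_trace (x + y) = cub_trace x + cub_trace y" "cub_trace (x - y) = cub_trace x - cub_trace y"
  "cub_trace (- x) = - cub_trace x" "cub_trace 0 = 0"
  by (simp_all add: cub_trace_def)

lemma hq_trace_diff: "hq_trace (x - y) = hq_trace x - hq_trace y"
  by (simp add: hq_eq_iff cub_trace_linear)

lemma hq_trace_conj: "hq_trace (hq_conj x) = hq_conj (hq_trace x)"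
  by (simp add: hq_eq_iff cub_trace_linear)

lemma hq_trace_of: "hq_trace (hq_of x) = hq_of (cub_trace x)"
  by (simp add: hq_eq_iff cub_trace_linear)

lemma hq_trace_int_mult: "hq_trace (hq_int q * x) = q * hq_trace x"
  by (simp add: hq_eq_iff hq_sel_times cub_trace_linear cub_trace_of_int_mult)

text \<open>The prime 7 is totally ramified with residue field of order 7, so the trace is congruent to
  three times the reduction.\<close>

lemma cub_trace_mult_mod_7: "7 dvd cub_trace x * cub_trace y - 3 * cub_trace (x * y)"
proof -
  have "cub_trace x * cub_trace y - 3 * cub_trace (x * y) =
    7 * (cf1 x * cf2 y + cf2 x * cf1 y - 2 * cf1 x * cf1 y - 2 * cf2 x * cf2 y)"
    by (simp add: cub_trace_def cub_sel_times algebra_simps)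
  then show ?thesis
    by simp
qed

lemma nrd_hq_trace_mod_7: "7 dvd nrd (hq_trace x) - 3 * cub_trace (nrd x)"
proof -
  define d where "d y z = cub_trace y * cub_trace z - 3 * cub_trace (y * z)" for y z
  have "nrd (hq_trace x) - 3 * cub_trace (nrd x) =
    d (qa x) (qa x) + d (qa x) (qb x) + d (qb x) (qb x) + d (qb x) (qc x) - d (qa x) (qd x)
    + d (qc x) (qc x) + d (qc x) (qd x) + d (qd x) (qd x)"
    by (simp add: nrd_def d_def power2_eq_square cub_trace_linear)
  also have "7 dvd \<dots>"
    by (intro dvd_add dvd_diff) (simp_all add: d_def cub_trace_mult_mod_7)
  finally show ?thesis .
qed

lemma cub_eval_nrd:
  assumes "cub_poly r = 0"
  shows "cub_eval r (nrd x) = nrd (map_hq (cub_eval r) x)"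
  by (simp add: nrd_def power2_eq_square cub_eval_add cub_eval_diff cub_eval_mult[OF assms])

lemma nrd_cub_eq_0: "nrd (x :: cub hq) = 0 \<Longrightarrow> x = 0"
proof -
  assume "nrd x = 0"
  obtain r :: real where r: "cub_poly r = 0"
    using cub_poly_root_exists by blast
  have "map_hq (cub_eval r) x = 0"
    using cub_eval_nrd[OF r, of x] \<open>nrd x = 0\<close> by (intro nrd_eq_0) simp
  then show "x = 0"
    by (simp add: hq_eq_iff cub_eval_eq_0_iff[OF r])
qed

text \<open>Gram determinant of the form Tr(m u v) on a basis that differs from 1, rho, rho^2 by a
  unimodular matrix: the discriminant 49 times N(m).\<close>

lemma cub_trace_gram_det:
  fixes m :: cub and k :: int
  defines "x \<equiv> cub_rho - of_int k" and "y \<equiv> (cub_rho - of_int k) * (cub_rho + of_int k)"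
  shows "cub_trace m * cub_trace (m * x * x) * cub_trace (m * y * y)
    + 2 * cub_trace (m * x) * cub_trace (m * x * y) * cub_trace (m * y)
    - cub_trace m * (cub_trace (m * x * y))\<^sup>2 - cub_trace (m * x * x) * (cub_trace (m * y))\<^sup>2
    - cub_trace (m * y * y) * (cub_trace (m * x))\<^sup>2 = 49 * cub_norm m"
proof -
  \<comment> \<open>\<open>t0\<close> to \<open>t4\<close> are the traces of m, m rho, ..., m rho^4,
    so the determinant becomes a Hankel determinant.\<close>
  define t0 t1 t2 t3 t4 where t: "t0 = 3 * cf0 m - cf1 m + 5 * cf2 m"
    "t1 = 5 * cf1 m - cf0 m - 4 * cf2 m" "t2 = 5 * cf0 m - 4 * cf1 m + 13 * cf2 m"
    "t3 = 13 * cf1 m - 4 * cf0 m - 16 * cf2 m" "t4 = 13 * cf0 m - 16 * cf1 m + 38 * cf2 m"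
  have eqs: "cub_trace m = t0" "cub_trace (m * x) = t1 - k * t0"
    "cub_trace (m * x * x) = t2 - 2 * k * t1 + k\<^sup>2 * t0"
    "cub_trace (m * y) = t2 - k\<^sup>2 * t0"
    "cub_trace (m * x * y) = t3 - k * t2 - k\<^sup>2 * t1 + k\<^sup>2 * k * t0"
    "cub_trace (m * y * y) = t4 - 2 * k\<^sup>2 * t2 + k\<^sup>2 * k\<^sup>2 * t0"
    by (simp_all add: x_def y_def t cub_trace_def cub_sel_times algebra_simps power2_eq_square)
  have "t0 * t2 * t4 + 2 * t1 * t2 * t3 - t0 * t3\<^sup>2 - t2 * t2\<^sup>2 - t4 * t1\<^sup>2 = 49 * cub_norm m"
    unfolding t cub_norm_def Let_def
    by (simp add: algebra_simps power2_eq_square power3_eq_cube)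
  then show ?thesis
    unfolding eqs by (simp add: algebra_simps power2_eq_square)
qed

text \<open>The pair \<open>(a, w)\<close> represents the element \<open>a\<beta> + \<lambda>w\<close>, and \<open>form u v\<close> is the product \<open>u v\<^sup>*\<close> of
  two such elements divided by \<open>\<lambda>\<close>.\<close>

locale divisor_lattice =
  fixes l f :: cub and k :: int and beta :: "int hq"
  assumes pos: "cub_totpos l"
    and divisor: "l * f = cub_rho - of_int k"
    and nrd_beta: "nrd beta = cub_norm l"
begin

definition elt :: "int hq \<times> cub hq \<Rightarrow> cub hq" where
  "elt u = hq_int (fst u) * hq_int beta + hq_of l * snd u"

text \<open>Division by \<open>l\<close> is avoided: the product of \<open>beta\<close> with its
  conjugate is N(l), whose quotient by \<open>l\<close> is \<open>cub_adj l\<close>; the other terms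
  contain \<open>l\<close> visibly.\<close>

definition form :: "int hq \<times> cub hq \<Rightarrow> int hq \<times> cub hq \<Rightarrow> cub hq" where
  "form u v = hq_of (cub_adj l) * (hq_int (fst u) * hq_conj (hq_int (fst v)))
     + hq_int (fst u) * hq_int beta * hq_conj (snd v)
     + snd u * hq_conj (hq_int beta) * hq_conj (hq_int (fst v))
     + hq_of l * (snd u * hq_conj (snd v))"

definition act :: "int hq \<Rightarrow> int hq \<times> cub hq \<Rightarrow> int hq \<times> cub hq" where
  "act q u = (q * fst u, hq_int q * snd u)"

definition herm :: "int hq \<times> cub hq \<Rightarrow> int hq \<times> cub hq \<Rightarrow> int hq" where
  "herm u v = hq_trace (form u v)"

definition quot :: "int hq \<times> cub hq \<Rightarrow> cub" where
  "quot u = qa (form u u)"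

lemma l_nonzero: "l \<noteq> 0"
  using cub_totpos_imp[OF pos] by auto

lemma form_eq: "hq_of l * form u v = elt u * hq_conj (elt v)"
proof -
  define a b c w x where "a = hq_int (fst u)" "b = hq_int (fst v)" "c = hq_int beta" "w = snd u" "x = snd v"
  have c: "c * hq_conj c = hq_of l * hq_of (cub_adj l)"
    by (simp add: mult_hq_conj a_b_c_w_x_def nrd_hq_int nrd_beta cub_norm_adj hq_of_hom)
  have 1: "(a * c) * (hq_conj c * hq_conj b) = hq_of l * (hq_of (cub_adj l) * (a * hq_conj b))"
  proof -
    have "(a * c) * (hq_conj c * hq_conj b) = a * ((c * hq_conj c) * hq_conj b)"
      by (simp only: mult.assoc)
    also have "\<dots> = hq_of l * (hq_of (cub_adj l) * (a * hq_conj b))"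
      by (simp only: c mult.assoc hq_of_left_commute[of a])
    finally show ?thesis .
  qed
  have "elt u * hq_conj (elt v) = (a * c + hq_of l * w) * (hq_conj c * hq_conj b + hq_of l * hq_conj x)"
    by (simp only: elt_def a_b_c_w_x_def hq_conj_add hq_conj_mult hq_conj_of hq_of_commute)
  also have "\<dots> = (a * c) * (hq_conj c * hq_conj b) + (a * c) * (hq_of l * hq_conj x)
      + hq_of l * w * (hq_conj c * hq_conj b) + hq_of l * w * (hq_of l * hq_conj x)"
    by (simp only: distrib_left distrib_right add.assoc add.left_commute)
  also have "\<dots> = hq_of l * (hq_of (cub_adj l) * (a * hq_conj b)) + hq_of l * (a * c * hq_conj x)
      + hq_of l * (w * hq_conj c * hq_conj b) + hq_of l * (hq_of l * (w * hq_conj x))"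
    by (simp only: 1 hq_of_left_commute[of "a * c"] mult.assoc[of "hq_of l"] hq_of_left_commute[of w] mult.assoc[of w])
  also have "\<dots> = hq_of l * form u v"
    by (simp only: form_def distrib_left a_b_c_w_x_def)
  finally show ?thesis ..
qed

lemma form_self: "form u u = hq_of (quot u)"
  and nrd_elt: "nrd (elt u) = l * quot u"
proof -
  have "hq_of l * form u u = hq_of (nrd (elt u))"
    by (simp add: form_eq mult_hq_conj)
  then show "form u u = hq_of (quot u)" and "nrd (elt u) = l * quot u"
    using l_nonzero by (auto simp: hq_eq_iff hq_sel_times quot_def)
qed

lemma quot_nonneg:
  assumes "cub_poly (r::real) = 0"
  shows "cub_eval r (quot u) \<ge> 0"
proof -
  have "cub_eval r l * cub_eval r (quot u) = nrd (map_hq (cub_eval r) (elt u))"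
    using nrd_elt[of u] cub_eval_mult[OF assms] cub_eval_nrd[OF assms] by metis
  then have "cub_eval r l * cub_eval r (quot u) \<ge> 0"
    by (simp add: nrd_nonneg)
  with pos assms show ?thesis
    by (auto simp: cub_totpos_def zero_le_mult_iff)
qed

lemma quot_totpos:
  assumes "quot u \<noteq> 0"
  shows "cub_totpos (quot u)"
  using assms quot_nonneg[of _ u] cub_eval_eq_0_iff[where ?'a = real]
  by (fastforce simp: cub_totpos_def order.order_iff_strict)

lemma trace_quot_eq_0: "cub_trace (quot u) = 0 \<Longrightarrow> quot u = 0"
  using quot_totpos[of u] cub_totpos_imp(1)[of "quot u"] by auto

sublocale hermitian_lattice act herm "\<lambda>u. cub_trace (quot u)"
proof
  fix u v w :: "int hq \<times> cub hq" and q :: "int hq"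
  show "herm (u - v) w = herm u w - herm v w"
    by (simp add: herm_def form_def hq_trace_diff[symmetric] hq_int_hom algebra_simps)
  have "form (act q u) w = hq_int q * form u w"
    by (simp only: form_def act_def fst_conv snd_conv hq_int_hom distrib_left mult.assoc
        hq_of_left_commute[of "hq_int q"])
  then show "herm (act q u) w = q * herm u w"
    by (simp add: herm_def hq_trace_int_mult)
  have "hq_of l * hq_conj (form u v) = hq_conj (hq_of l * form u v)"
    by (simp only: hq_conj_mult hq_conj_of hq_of_commute)
  also have "\<dots> = hq_of l * form v u"
    by (simp only: form_eq hq_conj_mult hq_conj_conj)
  finally have "hq_conj (form u v) = form v u"
    using l_nonzero hq_of_mult_cancel by blast
  then show "hq_conj (herm u v) = herm v u"
    by (simp add: herm_def hq_trace_conj[symmetric])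
  show "herm u u = hq_of (cub_trace (quot u))"
    by (simp add: herm_def form_self hq_trace_of)
  show "cub_trace (quot u) \<ge> 0"
    using quot_totpos[of u] cub_totpos_imp(1)[of "quot u"] by (cases "quot u = 0") (auto simp: cub_trace_linear)
  show "herm u v = 0" if "cub_trace (quot u) = 0"
  proof -
    have "elt u = 0"
      using trace_quot_eq_0[OF that] nrd_elt[of u] by (intro nrd_cub_eq_0) simp
    then have "form u v = 0"
      using form_eq[of u v] l_nonzero by (simp add: hq_of_mult_eq_0_iff)
    then show ?thesis
      by (simp add: herm_def hq_eq_iff cub_trace_linear)
  qed
  \<comment> \<open>Over K the form has rank one, so \<open>nrd (form u v) = quot u * quot v\<close>
    holds exactly; taking traces keeps this modulo 7.\<close>
  have "l * l * nrd (form u v) = nrd (hq_of l * form u v)"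
    by (simp add: nrd_mult power2_eq_square)
  also have "\<dots> = l * l * (quot u * quot v)"
    by (simp add: form_eq nrd_mult nrd_elt)
  finally have "nrd (form u v) = quot u * quot v"
    using l_nonzero by simp
  then have "7 dvd (cub_trace (quot u) * cub_trace (quot v) - 3 * cub_trace (quot u * quot v))
      - (nrd (herm u v) - 3 * cub_trace (quot u * quot v))"
    using nrd_hq_trace_mod_7[of "form u v"]
    by (intro dvd_diff[OF cub_trace_mult_mod_7]) (simp add: herm_def)
  then show "7 dvd cub_trace (quot u) * cub_trace (quot v) - nrd (herm u v)"
    by simp
qed

text \<open>The three pairs stand for \<open>beta\<close>, rho - k and rho^2 - k^2. Scaling by
  N(l)^2 turns the determinant into the one of \<open>cub_trace_gram_det\<close> for m =
  \<open>cub_adj l\<close>, and N(m) = N(l)^2 cancels the scaling.\<close>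

lemma gram3_basis: "gram3 (1, 0) (0, hq_of f) (0, hq_of (f * (cub_rho + of_int k))) = 49"
proof -
  define N where "N = cub_norm l"
  define m where "m = cub_adj l"
  define x y where "x = cub_rho - of_int k" "y = (cub_rho - of_int k) * (cub_rho + of_int k)"
  define g where "g = f * (cub_rho + of_int k)"
  have N: "of_int N = l * m"
    by (simp add: N_def m_def cub_norm_adj)
  have lf: "l * f = x" "l * g = y"
    by (simp_all add: x_y_def g_def divisor[symmetric] mult.assoc)
  have f: "of_int N * f = m * x" "of_int N * g = m * y"
    unfolding N lf[symmetric] by (simp_all add: mult_ac)
  have q: "of_int N * (l * f * f) = m * x * x" "of_int N * (l * f * g) = m * x * y" "of_int N * (l * g * g) = m * y * y"
    unfolding N lf[symmetric] by (simp_all add: mult_ac)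
  have tr: "N * cub_trace f = cub_trace (m * x)" "N * cub_trace g = cub_trace (m * y)"
    "N * cub_trace (l * f * f) = cub_trace (m * x * x)" "N * cub_trace (l * f * g) = cub_trace (m * x * y)"
    "N * cub_trace (l * g * g) = cub_trace (m * y * y)"
    by (simp_all only: f q flip: cub_trace_of_int_mult)
  have h1: "herm (1, 0) (0, hq_of z) = beta * hq_of (cub_trace z)" for z
    by (simp add: herm_def form_def hq_int_hom hq_trace_int_mult hq_trace_of)
  have h2: "herm (0, hq_of z) (0, hq_of z') = hq_of (cub_trace (l * z * z'))" for z z'
    by (simp add: herm_def form_def hq_int_hom hq_trace_of mult.assoc flip: hq_of_hom(3))
  have h3: "herm (0, hq_of z) (1, 0) = hq_of (cub_trace z) * hq_conj beta" for z
    using h_conj[of "(1, 0)" "(0, hq_of z)"] by (simp add: h1 hq_conj_mult)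
  have n1: "quot (1, 0) = m"
    by (simp add: quot_def form_def hq_int_hom m_def)
  have n2: "quot (0, hq_of z) = l * z * z" for z
    by (simp add: quot_def form_def hq_int_hom hq_sel_times mult.assoc)
  define A B C E F G where AG: "A = cub_trace m" "B = cub_trace f" "C = cub_trace g"
    "E = cub_trace (l * f * f)" "F = cub_trace (l * f * g)" "G = cub_trace (l * g * g)"
  have "trd (beta * hq_of B * hq_of F * (hq_of C * hq_conj beta)) = 2 * B * F * C * N"
  proof -
    have "beta * hq_of B * hq_of F * (hq_of C * hq_conj beta) = hq_of B * (hq_of F * (hq_of C * (beta * hq_conj beta)))"
      by (simp only: hq_of_commute[of beta] hq_of_left_commute[of beta] mult.assoc)
    also have "\<dots> = hq_of (B * (F * (C * N)))"
      by (simp only: mult_hq_conj nrd_beta N_def hq_of_hom)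
    finally show ?thesis
      by (simp add: trd_def)
  qed
  then have D: "gram3 (1, 0) (0, hq_of f) (0, hq_of g) =
      A * E * G + 2 * B * F * C * N - A * F\<^sup>2 - E * (N * C\<^sup>2) - G * (N * B\<^sup>2)"
    by (simp add: gram3_def h1 h2 h3 n1 n2 nrd_mult nrd_beta AG N_def)
  have "N\<^sup>2 * gram3 (1, 0) (0, hq_of f) (0, hq_of g) =
      A * (N * E) * (N * G) + 2 * (N * B) * (N * F) * (N * C) - A * (N * F)\<^sup>2
      - (N * E) * (N * C)\<^sup>2 - (N * G) * (N * B)\<^sup>2"
    unfolding D by (simp add: algebra_simps power2_eq_square)
  also have "\<dots> = 49 * cub_norm m"
    unfolding AG tr x_y_def by (rule cub_trace_gram_det)
  also have "cub_norm m = N\<^sup>2"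
    by (simp add: m_def cub_adj_def cub_norm_mult cub_norm_conj_eq N_def power2_eq_square)
  finally show ?thesis
    using l_nonzero by (simp add: N_def g_def)
qed

theorem exists_small_quotient: "\<exists>x :: cub hq. \<exists>m. nrd x = l * m \<and> cub_totpos m \<and> cub_trace m \<le> 6"
proof -
  obtain u where u: "0 < cub_trace (quot u)" "cub_trace (quot u) \<le> 6"
    using exists_short_vector[OF gram3_basis] by blast
  moreover have "quot u \<noteq> 0"
    using u by (auto simp: cub_trace_linear)
  ultimately show ?thesis
    using nrd_elt[of u] quot_totpos[of u] by blast
qed

end

section \<open>Totally positive elements of small trace, and the prime 2\<close>

lemma int_between_7: "\<bar>x\<bar> \<le> 3 \<Longrightarrow> x = -3 \<or> x = -2 \<or> x = -1 \<or> x = 0 \<or> x = 1 \<or> x = 2 \<or> x = (3::int)"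
  by linarith

text \<open>The enumeration uses the coordinates of \<open>-m\<close> in the normal basis \<open>\<rho>, \<rho>\<^sup>2 - 2, 1 - \<rho> - \<rho>\<^sup>2\<close>.\<close>

lemma cub_totpos_small_trace:
  assumes "cub_totpos m" "cub_trace m \<le> 6"
  shows "m = 2 \<or> (\<exists>e. \<bar>cub_norm e\<bar> = 1 \<and> m = e * e)"
proof -
  define x y z where xyz: "x = cf0 m + 2 * cf2 m - cf1 m" "y = cf0 m + cf2 m" "z = cf0 m + 2 * cf2 m"
  have m: "m = Cub (2 * y - z) (z - x) (z - y)"
    by (simp add: cub_eq_iff xyz)
  have tr: "cub_trace m = x + y + z"
    by (simp add: cub_trace_def xyz)
  \<comment> \<open>Both sides come from Tr(m^2). Trace at most 6 and
    \<open>cub_pairs m >= 1\<close> make the right side at most 106 < 7 * 16.\<close>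
  have "7 * (x\<^sup>2 + y\<^sup>2 + z\<^sup>2) = 3 * (cub_trace m)\<^sup>2 - 2 * cub_pairs m"
    by (simp add: cub_trace_def cub_pairs_def xyz Let_def algebra_simps power2_eq_square)
  moreover have "(cub_trace m)\<^sup>2 \<le> 6\<^sup>2"
    using assms cub_totpos_imp(1)[of m] by (intro power_mono) auto
  ultimately have sum: "x\<^sup>2 + y\<^sup>2 + z\<^sup>2 \<le> 15"
    using cub_totpos_imp(2)[OF assms(1)] by simp
  have bound: "\<bar>a\<bar> \<le> 3" if "a\<^sup>2 \<le> 15" for a :: int
    using that power_mono[of 4 "\<bar>a\<bar>" 2] by (cases "\<bar>a\<bar> \<le> 3") auto
  have "\<bar>x\<bar> \<le> 3" "\<bar>y\<bar> \<le> 3" "\<bar>z\<bar> \<le> 3"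
    using sum by (intro bound; smt (verit) zero_le_power2)+
  then have cases: "x = -3 \<or> x = -2 \<or> x = -1 \<or> x = 0 \<or> x = 1 \<or> x = 2 \<or> x = 3"
    "y = -3 \<or> y = -2 \<or> y = -1 \<or> y = 0 \<or> y = 1 \<or> y = 2 \<or> y = 3"
    "z = -3 \<or> z = -2 \<or> z = -1 \<or> z = 0 \<or> z = 1 \<or> z = 2 \<or> z = 3"
    by (simp_all only: int_between_7)
  have "x + y + z > 0" "x + y + z \<le> 6" "cub_pairs m > 0" "cub_norm m > 0"
    using cub_totpos_imp[OF assms(1)] assms(2) by (simp_all add: tr)
  \<comment> \<open>The Galois group permutes x, y, z cyclically. Of the two cyclic classes of
    arrangements of 1, 2, 3 only one has positive norm.\<close>
  then have "(x, y, z) \<in> {(1,1,1), (1,2,2), (1,2,3), (2,1,2), (2,2,1), (2,2,2), (2,3,1), (3,1,2)}"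
    unfolding m cub_pairs_def cub_norm_def using cases
    by (elim disjE) (simp_all add: Let_def)
  then show ?thesis
  proof (elim insertE emptyE)
    assume "(x, y, z) = (1,1,1)"
    then show ?thesis
      by (intro disjI2 exI[of _ 1]) (simp add: m cub_eq_iff)
  next
    assume "(x, y, z) = (1,2,2)"
    then show ?thesis
      by (intro disjI2 exI[of _ "Cub (-1) 1 1"]) (simp add: m cub_eq_iff cub_sel_times cub_norm_def)
  next
    assume "(x, y, z) = (1,2,3)"
    then show ?thesis
      by (intro disjI2 exI[of _ "Cub 1 1 0"]) (simp add: m cub_eq_iff cub_sel_times cub_norm_def)
  next
    assume "(x, y, z) = (2,1,2)"
    then show ?thesis
      by (intro disjI2 exI[of _ "Cub 0 1 0"]) (simp add: m cub_eq_iff cub_sel_times cub_norm_def)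
  next
    assume "(x, y, z) = (2,2,1)"
    then show ?thesis
      by (intro disjI2 exI[of _ "Cub (-2) 0 1"]) (simp add: m cub_eq_iff cub_sel_times cub_norm_def)
  next
    assume "(x, y, z) = (2,2,2)"
    then show ?thesis
      by (intro disjI1) (simp add: m cub_eq_iff)
  next
    assume "(x, y, z) = (2,3,1)"
    then show ?thesis
      by (intro disjI2 exI[of _ "Cub (-2) 1 1"]) (simp add: m cub_eq_iff cub_sel_times cub_norm_def)
  next
    assume "(x, y, z) = (3,1,2)"
    then show ?thesis
      by (intro disjI2 exI[of _ "Cub (-1) 0 1"]) (simp add: m cub_eq_iff cub_sel_times cub_norm_def)
  qed
qed

lemma cub_unit_inverse:
  assumes "\<bar>cub_norm e\<bar> = 1"
  obtains e' where "e * e' = 1"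
proof
  have "e * (of_int (cub_norm e) * cub_adj e) = of_int (cub_norm e) * (e * cub_adj e)"
    by (simp only: mult_ac)
  also have "\<dots> = of_int (cub_norm e * cub_norm e)"
    by (simp add: cub_norm_adj)
  also have "cub_norm e * cub_norm e = 1"
    using assms by (auto simp: abs_if split: if_splits)
  finally show "e * (of_int (cub_norm e) * cub_adj e) = 1"
    by simp
qed

lemma two_dvd_cub_iff: "(2 :: cub) dvd x \<longleftrightarrow> even (cf0 x) \<and> even (cf1 x) \<and> even (cf2 x)"
  using cub_of_int_dvd_iff[of 2 x] by simp

text \<open>The residue field of 2 has order 8 and hence contains no primitive cube root of unity.\<close>

lemma two_dvd_cub_binary:
  assumes "(2 :: cub) dvd s * s + s * t + t * t"
  shows "2 dvd s" "2 dvd t"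
proof -
  have "2 dvd s \<and> 2 dvd t"
    using assms unfolding two_dvd_cub_iff
    by (cases "even (cf0 s)"; cases "even (cf1 s)"; cases "even (cf2 s)";
        cases "even (cf0 t)"; cases "even (cf1 t)"; cases "even (cf2 t)") (simp_all add: cub_sel_times)
  then show "2 dvd s" "2 dvd t"
    by auto
qed

text \<open>Modulo the two-sided ideal of 1 + i, a quaternion is determined by s and t, and its
  reduced norm is s^2 + st + t^2. This form is anisotropic over the field with 8 elements, so x is
  divisible by 1 + i.\<close>

lemma nrd_divide_2:
  fixes x :: "cub hq"
  assumes "nrd x = l * 2"
  shows "\<exists>y :: cub hq. nrd y = l"
proof -
  define s t where st: "s = qa x + qc x" "t = qb x + qd x"
  have "s * s + s * t + t * t = 2 * (l + qa x * qc x + qa x * qd x + qb x * qd x)"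
    using assms by (simp add: nrd_def st algebra_simps power2_eq_square)
  then have "2 dvd s * s + s * t + t * t"
    by simp
  then obtain s' t' where "s = 2 * s'" "t = 2 * t'"
    using two_dvd_cub_binary by (metis dvdE)
  then have ad: "qa x = 2 * s' - qc x" "qb x = 2 * t' - qd x"
    by (simp_all add: st algebra_simps)
  \<comment> \<open>The quotient of x by 1 + i, that is (1 - i) x / 2.\<close>
  define y where "y = HQ (s' + t') (t' - qd x) (qc x - s' - t' + qd x) t'"
  have "hq_of 2 * y = HQ 1 0 (-1) 0 * x"
    by (simp add: hq_eq_iff hq_sel_times y_def ad algebra_simps)
  then have "nrd (hq_of 2 * y) = nrd (HQ 1 0 (-1) 0) * nrd x"
    by (simp only: nrd_mult)
  moreover have "nrd (HQ 1 0 (-1) 0) = (2 :: cub)"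
    by (simp add: nrd_def)
  ultimately have "4 * nrd y = 4 * l"
    by (simp add: nrd_mult assms)
  then show ?thesis
    by auto
qed

lemma nrd_divisor:
  assumes "cub_totpos l" "l dvd cub_rho - of_int k"
  shows "\<exists>x :: cub hq. nrd x = l"
proof -
  obtain f where f: "l * f = cub_rho - of_int k"
    using assms(2) by (metis dvdE)
  obtain b :: "int hq" where b: "nrd b = cub_norm l"
    using pos_int_is_nrd cub_totpos_imp(3)[OF assms(1)] by blast
  interpret divisor_lattice l f k b
    by unfold_locales (use assms f b in auto)
  obtain x :: "cub hq" and m where x: "nrd x = l * m" "cub_totpos m" "cub_trace m \<le> 6"
    using exists_small_quotient by blast
  from cub_totpos_small_trace[OF x(2,3)] show ?thesis
  proof
    assume "m = 2"
    then show ?thesis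
      using nrd_divide_2 x(1) by blast
  next
    assume "\<exists>e. \<bar>cub_norm e\<bar> = 1 \<and> m = e * e"
    then obtain e e' where e: "m = e * e" "e * e' = 1"
      using cub_unit_inverse by metis
    have "nrd (hq_of e' * x) = l * ((e * e') * (e * e'))"
      by (simp only: nrd_mult nrd_of x(1) e(1) power2_eq_square mult_ac)
    then have "nrd (hq_of e' * x) = l"
      by (simp add: e(2))
    then show ?thesis
      by blast
  qed
qed

section \<open>Division with remainder in the cubic ring\<close>

text \<open>Tr(v^2) for v with coordinates x, y, z in the normal basis up to sign: a conjugate of
  rho has square of trace 5, and two distinct ones have product of trace -2.\<close>

definition trace_form :: "'a::comm_ring_1 \<Rightarrow> 'a \<Rightarrow> 'a \<Rightarrow> 'a" where
  "trace_form x y z = 7 * (x\<^sup>2 + y\<^sup>2 + z\<^sup>2) - 2 * (x + y + z)\<^sup>2"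

text \<open>The point \<open>(x, y, z)\<close> is the convex combination of the four vertices with the weights
  \<open>1 - x\<close>, \<open>x - y\<close>, \<open>y - z\<close>, \<open>z\<close>; the average of the four values is at most \<open>9/4\<close>.\<close>

lemma trace_form_sorted:
  fixes x y z :: real
  assumes "0 \<le> z" "z \<le> y" "y \<le> x" "x \<le> 1"
  shows "trace_form x y z < 3 \<or> trace_form (x - 1) y z < 3 \<or> trace_form (x - 1) (y - 1) z < 3
    \<or> trace_form (x - 1) (y - 1) (z - 1) < 3"
proof (rule ccontr)
  assume "\<not> ?thesis"
  then have ge: "trace_form x y z \<ge> 3" "trace_form (x - 1) y z \<ge> 3" "trace_form (x - 1) (y - 1) z \<ge> 3"
    "trace_form (x - 1) (y - 1) (z - 1) \<ge> 3"
    by simp_all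
  define a b c d where w: "a = 1 - x" "b = x - y" "c = y - z" "d = z"
  have nn: "a \<ge> 0" "b \<ge> 0" "c \<ge> 0" "d \<ge> 0"
    using assms by (auto simp: w)
  have abcd: "a + b + c + d = 1"
    by (simp add: w)
  have "3 = a * 3 + b * 3 + c * 3 + d * 3"
    using abcd by simp
  also have "\<dots> \<le> a * trace_form x y z + b * trace_form (x - 1) y z + c * trace_form (x - 1) (y - 1) z
      + d * trace_form (x - 1) (y - 1) (z - 1)"
    using nn ge by (intro add_mono mult_left_mono)
  \<comment> \<open>The mean of a quadratic form around the barycentre is the sum, over pairs of
    vertices, of the product of weights times the value on the edge; edges have value 5, 6 or
    3.\<close>
  also have "\<dots> = 5 * (a * b) + 6 * (a * c) + 3 * (a * d) + 5 * (b * c) + 6 * (b * d) + 5 * (c * d)"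
    by (simp add: w trace_form_def algebra_simps power2_eq_square)
  finally have "3 \<le> 5 * (a * b) + 6 * (a * c) + 3 * (a * d) + 5 * (b * c) + 6 * (b * d) + 5 * (c * d)" .
  moreover have "a * b \<ge> 0" "a * c \<ge> 0" "a * d \<ge> 0" "b * c \<ge> 0" "b * d \<ge> 0" "c * d \<ge> 0"
    using nn by simp_all
  ultimately have "3 \<le> 6 * (a * b) + 6 * (a * c) + 6 * (a * d) + 6 * (b * c) + 6 * (b * d) + 6 * (c * d)"
    by linarith
  moreover have "8 * (a * b) + 8 * (a * c) + 8 * (a * d) + 8 * (b * c) + 8 * (b * d) + 8 * (c * d)
    = 3 * (a + b + c + d)\<^sup>2 - ((a - b)\<^sup>2 + (a - c)\<^sup>2 + (a - d)\<^sup>2 + (b - c)\<^sup>2 + (b - d)\<^sup>2 + (c - d)\<^sup>2)"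
    by (simp add: algebra_simps power2_eq_square)
  moreover have "(a - b)\<^sup>2 + (a - c)\<^sup>2 + (a - d)\<^sup>2 + (b - c)\<^sup>2 + (b - d)\<^sup>2 + (c - d)\<^sup>2 \<ge> 0"
    by simp
  moreover have "3 * (a + b + c + d)\<^sup>2 = 3"
    by (simp add: abcd)
  ultimately show False
    by linarith
qed

text \<open>Integer translations lead to the unit cube, and permuting coordinates leads to the
  simplex of sorted ones.\<close>

lemma trace_form_covering:
  fixes x y z :: real
  shows "\<exists>(i::int) (j::int) (k::int). trace_form (x - i) (y - j) (z - k) < 3"
proof -
  define P where "P x y z \<longleftrightarrow> (\<exists>(i::int) (j::int) (k::int). trace_form (x - i) (y - j) (z - k) < 3)" for x y z :: real
  have sorted: "P x y z" if "0 \<le> z" "z \<le> y" "y \<le> x" "x \<le> 1" for x y z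
    using trace_form_sorted[OF that] unfolding P_def
    by (metis diff_zero of_int_0 of_int_1)
  have sym: "trace_form x y z = trace_form y x z" "trace_form x y z = trace_form x z y" for x y z :: real
    by (simp_all add: trace_form_def add_ac)
  have swap1: "P y x z" if P: "P x y z" for x y z
  proof -
    obtain i j k :: int where "trace_form (x - i) (y - j) (z - k) < 3"
      using P unfolding P_def by blast
    then have "trace_form (y - j) (x - i) (z - k) < 3"
      by (simp only: sym(1)[of "y - j"])
    then show ?thesis
      unfolding P_def by blast
  qed
  have swap2: "P x z y" if P: "P x y z" for x y z
  proof -
    obtain i j k :: int where "trace_form (x - i) (y - j) (z - k) < 3"
      using P unfolding P_def by blast
    then have "trace_form (x - i) (z - k) (y - j) < 3"
      by (simp only: sym(2)[of "x - i" "z - k"])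
    then show ?thesis
      unfolding P_def by blast
  qed
  have "P (frac x) (frac y) (frac z)"
  proof -
    have *: "0 \<le> frac t" "frac t \<le> 1" for t :: real
      by (auto simp: frac_lt_1 less_imp_le)
    consider "frac z \<le> frac y" "frac y \<le> frac x" | "frac y \<le> frac z" "frac z \<le> frac x"
      | "frac z \<le> frac x" "frac x \<le> frac y" | "frac x \<le> frac z" "frac z \<le> frac y"
      | "frac y \<le> frac x" "frac x \<le> frac z" | "frac x \<le> frac y" "frac y \<le> frac z"
      by linarith
    then show ?thesis
    proof cases
      case 1
      show ?thesis
        by (rule sorted) (use 1 * in auto)
    next
      case 2
      show ?thesis
        by (rule swap2[OF sorted]) (use 2 * in auto)
    next
      case 3
      show ?thesis
        by (rule swap1[OF sorted]) (use 3 * in auto)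
    next
      case 4
      show ?thesis
        by (rule swap1[OF swap2[OF sorted]]) (use 4 * in auto)
    next
      case 5
      show ?thesis
        by (rule swap2[OF swap1[OF sorted]]) (use 5 * in auto)
    next
      case 6
      show ?thesis
        by (rule swap1[OF swap2[OF swap1[OF sorted]]]) (use 6 * in auto)
    qed
  qed
  then obtain i j k :: int where "trace_form (frac x - i) (frac y - j) (frac z - k) < 3"
    unfolding P_def by blast
  then have "trace_form (x - (\<lfloor>x\<rfloor> + i)) (y - (\<lfloor>y\<rfloor> + j)) (z - (\<lfloor>z\<rfloor> + k)) < 3"
    by (simp add: frac_def algebra_simps)
  then show ?thesis
    by (metis of_int_add)
qed

lemma arith_geo_mean_3:
  fixes a b c :: real
  assumes "a \<ge> 0" "b \<ge> 0" "c \<ge> 0"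
  shows "27 * (a * b * c) \<le> (a + b + c) ^ 3"
proof -
  have "a * (b - c)\<^sup>2 \<ge> 0" "b * (a - c)\<^sup>2 \<ge> 0" "c * (a - b)\<^sup>2 \<ge> 0"
    "(a + b + c) * ((a - b)\<^sup>2 + (b - c)\<^sup>2 + (a - c)\<^sup>2) \<ge> 0"
    using assms by simp_all
  then show ?thesis
    by (simp add: algebra_simps power2_eq_square power3_eq_cube)
qed

text \<open>Arithmetic-geometric mean for the squares of the three real conjugates.\<close>

lemma cub_norm_trace_bound: "27 * (cub_norm x)\<^sup>2 \<le> (cub_trace (x * x)) ^ 3"
proof -
  obtain r :: real where r: "cub_poly r = 0"
    using cub_poly_root_exists by blast
  have r2: "cub_poly (r\<^sup>2 - 2) = 0" "cub_poly ((r\<^sup>2 - 2)\<^sup>2 - 2) = 0"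
    using r by (simp_all add: cub_poly_root_conj)
  have "27 * (real_of_int (cub_norm x))\<^sup>2 \<le> (real_of_int (cub_trace (x * x))) ^ 3"
    unfolding cub_eval_norm[OF r] cub_eval_trace[OF r] cub_eval_mult[OF r] cub_eval_mult[OF r2(1)] cub_eval_mult[OF r2(2)]
    using arith_geo_mean_3[of "cub_eval r x * cub_eval r x" "cub_eval (r\<^sup>2 - 2) x * cub_eval (r\<^sup>2 - 2) x"
        "cub_eval ((r\<^sup>2 - 2)\<^sup>2 - 2) x * cub_eval ((r\<^sup>2 - 2)\<^sup>2 - 2) x"]
    by (simp add: power2_eq_square mult_ac)
  then have "real_of_int (27 * (cub_norm x)\<^sup>2) \<le> real_of_int ((cub_trace (x * x)) ^ 3)"
    by simp
  then show ?thesis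
    by (simp only: of_int_le_iff)
qed

lemma cub_trace_square:
  "cub_trace (x * x) = trace_form (cf0 x + 2 * cf2 x - cf1 x) (cf0 x + cf2 x) (cf0 x + 2 * cf2 x)"
  by (simp add: cub_trace_def trace_form_def cub_sel_times algebra_simps power2_eq_square)

text \<open>Write a/b as v/n with n = N(b) and choose q with Tr((v/n - q)^2) < 3; the bound 27 N^2
  <= Tr^3 then forces the norm of a/b - q below 1 in absolute value.\<close>

lemma cub_division:
  assumes "b \<noteq> 0"
  obtains q where "\<bar>cub_norm (a - q * b)\<bar> < \<bar>cub_norm b\<bar>"
proof -
  define n where "n = cub_norm b"
  define v where "v = a * cub_adj b"
  have n: "n \<noteq> 0"
    using assms by (simp add: n_def)
  define x y z where xyz: "x = cf0 v + 2 * cf2 v - cf1 v" "y = cf0 v + cf2 v" "z = cf0 v + 2 * cf2 v"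
  obtain i j k :: int where ijk: "trace_form (x / n - i) (y / n - j) (z / n - k) < 3"
    using trace_form_covering by blast
  \<comment> \<open>The element with coordinates i, j, k, inverting the change of basis in
    \<open>xyz\<close>.\<close>
  define q where "q = Cub (2 * j - k) (k - i) (k - j)"
  define w where "w = v - of_int n * q"
  have "cub_trace (w * w) = trace_form (x - n * i) (y - n * j) (z - n * k)"
    unfolding cub_trace_square by (simp add: w_def q_def cub_sel_times xyz algebra_simps)
  then have "real_of_int (cub_trace (w * w)) = trace_form (real_of_int x - n * i) (y - n * j) (z - n * k)"
    by (simp add: trace_form_def)
  also have "\<dots> = (real_of_int n)\<^sup>2 * trace_form (x / n - i) (y / n - j) (z / n - k)"
    using n by (simp add: trace_form_def field_simps power2_eq_square)
  also have "\<dots> < (real_of_int n)\<^sup>2 * 3"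
    using ijk n by (intro mult_strict_left_mono) auto
  finally have "real_of_int (cub_trace (w * w)) < real_of_int (3 * n\<^sup>2)"
    by simp
  then have tr: "cub_trace (w * w) < 3 * n\<^sup>2"
    by (simp only: of_int_less_iff)
  have "27 * (cub_norm w)\<^sup>2 \<le> (cub_trace (w * w)) ^ 3"
    by (rule cub_norm_trace_bound)
  also have "\<dots> < (3 * n\<^sup>2) ^ 3"
  proof (rule power_strict_mono[OF tr])
    show "0 \<le> cub_trace (w * w)"
    proof (rule ccontr)
      assume "\<not> 0 \<le> cub_trace (w * w)"
      then have "cub_trace (w * w) ^ 3 < 0"
        by simp
      with cub_norm_trace_bound[of w] show False
        by (smt (verit) zero_le_power2)
    qed
  qed simp
  finally have "(cub_norm w)\<^sup>2 < (n\<^sup>2 * n)\<^sup>2"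
    by (simp add: power2_eq_square power3_eq_cube algebra_simps)
  moreover have "w = cub_adj b * (a - q * b)"
    by (simp add: w_def v_def n_def cub_norm_adj algebra_simps)
  then have "cub_norm w = n\<^sup>2 * cub_norm (a - q * b)"
    by (simp add: cub_norm_mult cub_adj_def cub_norm_conj_eq n_def power2_eq_square)
  ultimately have "\<bar>n\<^sup>2 * cub_norm (a - q * b)\<bar> < \<bar>n\<^sup>2 * n\<bar>"
    using abs_le_square_iff[of "n\<^sup>2 * n" "cub_norm w"] by simp
  then have "n\<^sup>2 * \<bar>cub_norm (a - q * b)\<bar> < n\<^sup>2 * \<bar>n\<bar>"
    by (simp add: abs_mult)
  then have "\<bar>cub_norm (a - q * b)\<bar> < \<bar>cub_norm b\<bar>"
    using n by (simp add: n_def)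
  then show thesis
    by (rule that)
qed

section \<open>Factorisation\<close>

lemma cub_real_roots:
  fixes r s :: real
  assumes "cub_poly r = 0" "cub_poly s = 0"
  shows "s = r \<or> s = r\<^sup>2 - 2 \<or> s = (r\<^sup>2 - 2)\<^sup>2 - 2"
proof -
  have r3: "(r\<^sup>2 - 2)\<^sup>2 - 2 = 1 - r - r\<^sup>2 + cub_poly r * (r - 1)"
    by (simp add: cub_poly_def algebra_simps power2_eq_square power3_eq_cube)
  have "(s - r) * (s - (r\<^sup>2 - 2)) * (s - (1 - r - r\<^sup>2)) = cub_poly s + cub_poly r * (r\<^sup>2 - 1 - r * s)"
    by (simp add: cub_poly_def algebra_simps power2_eq_square power3_eq_cube)
  then have "(s - r) * (s - (r\<^sup>2 - 2)) * (s - (1 - r - r\<^sup>2)) = 0"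
    using assms by simp
  then show ?thesis
    using r3 assms by auto
qed

text \<open>The conjugates of \<open>\<rho>\<close> have product 1 and sum -1, so exactly one of them is positive.\<close>

lemma cub_make_totpos:
  assumes "x \<noteq> 0"
  obtains e e' where "e * e' = 1" "cub_totpos (e * x)"
proof -
  obtain r :: real where r: "cub_poly r = 0"
    using cub_poly_root_exists by blast
  define s t where st: "s = r\<^sup>2 - 2" "t = s\<^sup>2 - 2"
  have roots: "cub_poly s = 0" "cub_poly t = 0"
    using r by (simp_all add: st cub_poly_root_conj)
  have ev: "cub_eval q (z * w) = cub_eval q z * cub_eval q w" if "q \<in> {r, s, t}" for q z w
    using that r roots by (auto simp: cub_eval_mult)
  have totpos: "cub_totpos z" if "cub_eval r z > 0" "cub_eval s z > 0" "cub_eval t z > 0" for z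
    using that cub_real_roots[OF r] by (auto simp: cub_totpos_def st)
  define u where "u = cub_conj cub_rho"
  define v where "v = cub_conj u"
  have t2: "t\<^sup>2 - 2 = r"
    using arg_cong[OF cub_conj_conj_conj[of cub_rho], of "cub_eval r"] r roots
    by (simp add: cub_eval_conj st)
  have uv: "cub_eval r u = s" "cub_eval s u = t" "cub_eval t u = r"
    "cub_eval r v = t" "cub_eval s v = r" "cub_eval t v = s"
    unfolding v_def u_def using r roots t2 by (simp_all add: cub_eval_conj flip: st)
  have prod: "r * s * t = 1" and sum: "r + s + t = -1"
    using cub_eval_norm[OF r, of cub_rho] cub_eval_trace[OF r, of cub_rho]
    by (simp_all add: st cub_norm_def cub_trace_def)
  have unit: "cub_rho * (u * v) = 1"
    by (simp add: cub_eq_iff u_def v_def cub_sel_times)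
  have signs: "(r > 0 \<and> s < 0 \<and> t < 0) \<or> (r < 0 \<and> s > 0 \<and> t < 0) \<or> (r < 0 \<and> s < 0 \<and> t > 0)"
  proof -
    have "r \<noteq> 0" "s \<noteq> 0" "t \<noteq> 0"
      using prod by auto
    moreover have "r * s * t > 0"
      using prod by simp
    ultimately show ?thesis
      using sum by (auto simp: zero_less_mult_iff mult_less_0_iff)
  qed
  have pos_unit: "\<exists>e e'. e * e' = 1 \<and> cub_totpos (e * x)" if N: "cub_norm x > 0" for x
  proof -
    define a b c where abc: "a = cub_eval r x" "b = cub_eval s x" "c = cub_eval t x"
    have "x \<noteq> 0"
      using N by auto
    then have nz: "a \<noteq> 0" "b \<noteq> 0" "c \<noteq> 0"
      using r roots by (simp_all add: abc cub_eval_eq_0_iff)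
    have "real_of_int (cub_norm x) = a * b * c"
      using cub_eval_norm[OF r, of x] by (simp add: abc st)
    then have abc0: "a * b * c > 0"
      using N by (metis of_int_0_less_iff)
    consider "a > 0" "b > 0" "c > 0" | "a > 0" "b < 0" "c < 0" | "a < 0" "b > 0" "c < 0" | "a < 0" "b < 0" "c > 0"
      using nz abc0 by (auto simp: zero_less_mult_iff mult_less_0_iff)
    then show ?thesis
    proof cases
      case 1
      then have "cub_totpos (1 * x)"
        by (intro totpos) (simp_all add: abc)
      then show ?thesis
        by (metis mult_1)
    next
      case 2
      \<comment> \<open>The sign patterns of rho, u, v at r, s, t are the three cyclic shifts of one
        plus and two minuses, so one of them agrees with that of x.\<close>
      have "cub_totpos (cub_rho * x) \<or> cub_totpos (u * x) \<or> cub_totpos (v * x)"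
        using signs 2 by (elim disjE) (auto intro!: totpos simp: ev uv mult_neg_neg simp flip: abc)
      then show ?thesis
        using unit by (metis mult.commute mult.left_commute)
    next
      case 3
      have "cub_totpos (cub_rho * x) \<or> cub_totpos (u * x) \<or> cub_totpos (v * x)"
        using signs 3 by (elim disjE) (auto intro!: totpos simp: ev uv mult_neg_neg simp flip: abc)
      then show ?thesis
        using unit by (metis mult.commute mult.left_commute)
    next
      case 4
      have "cub_totpos (cub_rho * x) \<or> cub_totpos (u * x) \<or> cub_totpos (v * x)"
        using signs 4 by (elim disjE) (auto intro!: totpos simp: ev uv mult_neg_neg simp flip: abc)
      then show ?thesis
        using unit by (metis mult.commute mult.left_commute)
    qed
  qed
  show thesis
  proof (cases "cub_norm x > 0")
    case True
    then show thesis
      using pos_unit that by blast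
  next
    case False
    then have "cub_norm (- x) > 0"
      using assms by (simp add: cub_norm_minus less_le)
    then obtain e e' where "e * e' = 1" "cub_totpos (e * (- x))"
      using pos_unit by blast
    then have "(- e) * (- e') = 1" "cub_totpos ((- e) * x)"
      by simp_all
    then show thesis
      by (rule that)
  qed
qed

lemma cub_totpos_divide:
  assumes "cub_totpos (x * y)" "cub_totpos x"
  shows "cub_totpos y"
  using assms by (auto simp: cub_totpos_def cub_eval_mult zero_less_mult_iff dest: less_imp_not_less)

section \<open>Rational primes dividing a norm\<close>

lemma int_prime_inverse:
  fixes p e :: int
  assumes "prime p" "\<not> p dvd e"
  obtains d m where "e * d = 1 + p * m"
proof -
  have "coprime e p"
    using assms prime_imp_coprime coprime_commute by blast
  then obtain u v where "u * e + v * p = 1"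
    using bezout_int[of e p] by (auto simp: coprime_iff_gcd_eq_1)
  then have "e * u = 1 + p * (- v)"
    by (simp add: algebra_simps)
  then show thesis
    by (rule that)
qed

text \<open>N(g + e rho) is the homogenised cubic, so -g/e would be a root modulo p if e were
  invertible.\<close>

lemma prime_dvd_norm_linear:
  fixes p g e :: int
  assumes p: "prime p" and noroot: "\<And>r. \<not> p dvd cub_poly r" and dvd: "p dvd cub_norm (Cub g e 0)"
  shows "p dvd e" "p dvd g"
proof -
  have N: "cub_norm (Cub g e 0) = g ^ 3 - g\<^sup>2 * e - 2 * g * e\<^sup>2 + e ^ 3"
    by (simp add: cub_norm_def)
  show e: "p dvd e"
  proof (rule ccontr)
    assume "\<not> p dvd e"
    then obtain d m where d: "e * d = 1 + p * m"
      using int_prime_inverse[OF p] by blast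
    have "d ^ 3 * cub_norm (Cub g e 0) = (g * d) ^ 3 - (g * d)\<^sup>2 * (e * d) - 2 * (g * d) * (e * d)\<^sup>2 + (e * d) ^ 3"
      unfolding N by (simp add: algebra_simps power2_eq_square power3_eq_cube)
    also have "\<dots> = - cub_poly (- (g * d)) + p * (- (g * d)\<^sup>2 * m - 2 * (g * d) * (2 * m + p * m\<^sup>2)
        + (3 * m + 3 * p * m\<^sup>2 + p\<^sup>2 * m ^ 3))"
      unfolding d by (simp add: cub_poly_def algebra_simps power2_eq_square power3_eq_cube)
    finally have "cub_poly (- (g * d)) = p * (- (g * d)\<^sup>2 * m - 2 * (g * d) * (2 * m + p * m\<^sup>2)
        + (3 * m + 3 * p * m\<^sup>2 + p\<^sup>2 * m ^ 3)) - d ^ 3 * cub_norm (Cub g e 0)"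
      by simp
    then have "p dvd cub_poly (- (g * d))"
      using dvd by simp
    with noroot show False
      by blast
  qed
  have "p dvd g ^ 3 - g\<^sup>2 * e - 2 * g * e\<^sup>2 + e ^ 3 + (g\<^sup>2 + 2 * g * e - e\<^sup>2) * e"
    using dvd e unfolding N by (intro dvd_add[OF _ dvd_mult]) auto
  then have "p dvd g ^ 3"
    by (simp add: algebra_simps power2_eq_square power3_eq_cube)
  then show "p dvd g"
    using p prime_dvd_power by blast
qed

text \<open>If \<open>p\<close> divides the norm of \<open>x = a + b\<rho> + c\<rho>\<^sup>2\<close> but not \<open>x\<close>, then the Euclidean algorithm for
  \<open>X\<^sup>3 + X\<^sup>2 - 2X - 1\<close> and \<open>a + bX + cX\<^sup>2\<close> modulo \<open>p\<close> produces a root modulo \<open>p\<close>.\<close>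

lemma prime_dvd_norm_inert:
  fixes p :: int
  assumes p: "prime p" and noroot: "\<And>r. \<not> p dvd cub_poly r" and dvd: "p dvd cub_norm x"
  shows "(of_int p :: cub) dvd x"
proof -
  define a b c where abc: "a = cf0 x" "b = cf1 x" "c = cf2 x"
  have x: "x = Cub a b c"
    by (simp add: abc cub_eq_iff)
  have c: "p dvd c"
  proof (rule ccontr)
    assume nc: "\<not> p dvd c"
    \<comment> \<open>Division of c^2 times the cubic by a + bX + cX^2 has quotient cX + d and
      remainder eX + g. At rho this gives x (d + c rho) = -(g + e rho), so p divides the norm of the
      remainder.\<close>
    define d where "d = c - b"
    define e where "e = - 2 * c\<^sup>2 - a * c - b * d"
    define g where "g = - c\<^sup>2 - a * d"
    have "x * Cub d c 0 = - Cub g e 0"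
      by (simp add: cub_eq_iff cub_sel_times x d_def e_def g_def algebra_simps power2_eq_square)
    then have "cub_norm (Cub g e 0) = - (cub_norm x * cub_norm (Cub d c 0))"
      by (metis cub_norm_minus cub_norm_mult minus_minus)
    then have "p dvd cub_norm (Cub g e 0)"
      using dvd by simp
    then have eg: "p dvd e" "p dvd g"
      using prime_dvd_norm_linear[OF p noroot] by blast+
    obtain i m where i: "c * i = 1 + p * m"
      using int_prime_inverse[OF p nc] by blast
    \<comment> \<open>The root of the quotient cX + d modulo p; with the remainder gone it is a root
      of the cubic.\<close>
    define y where "y = - d * i"
    have "c\<^sup>2 * cub_poly y = (a + b * y + c * y\<^sup>2) * (c * y + d) + (e * y + g)"
      by (simp add: cub_poly_def e_def g_def d_def algebra_simps power2_eq_square power3_eq_cube)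
    also have "c * y + d = p * (- d * m)"
    proof -
      have "c * y + d = - d * (c * i) + d"
        by (simp add: y_def)
      then show ?thesis
        by (simp add: i algebra_simps)
    qed
    finally have "c\<^sup>2 * cub_poly y = (a + b * y + c * y\<^sup>2) * (p * (- d * m)) + (e * y + g)" .
    moreover have "p dvd (a + b * y + c * y\<^sup>2) * (p * (- d * m)) + (e * y + g)"
      using eg by simp
    ultimately have "p dvd c\<^sup>2 * cub_poly y"
      by simp
    then have "p dvd c\<^sup>2 \<or> p dvd cub_poly y"
      using p prime_dvd_mult_iff by blast
    then show False
      using nc noroot p prime_dvd_power by blast
  qed
  have "cub_norm x - cub_norm (Cub a b 0) = c * (5 * a\<^sup>2 - a * b + 6 * a * c - b\<^sup>2 - 2 * b * c + c\<^sup>2)"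
    by (simp add: x cub_norm_def algebra_simps power2_eq_square power3_eq_cube)
  then have "p dvd cub_norm x - cub_norm (Cub a b 0)"
    using c by simp
  then have "p dvd cub_norm (Cub a b 0)"
    using dvd dvd_diffD1 by (metis dvd_diff diff_diff_eq2 add_diff_cancel_left')
  then have "p dvd b" "p dvd a"
    using prime_dvd_norm_linear[OF p noroot] by blast+
  with c show ?thesis
    by (simp add: cub_of_int_dvd_iff abc)
qed

lemma cub_eval_mod_mult:
  fixes p r :: int
  assumes "p dvd cub_poly r"
  shows "p dvd cub_eval r x * cub_eval r y - cub_eval r (x * y)"
  using assms by (simp add: cub_eval_mult_diff)

text \<open>Modulo p the norm is the product of the values at r of x and its conjugates, and a
  conjugate takes at r the value of x at another root.\<close>

lemma prime_dvd_norm_split: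
  fixes p r :: int
  assumes p: "prime p" and r: "p dvd cub_poly r" and dvd: "p dvd cub_norm x"
  obtains s where "p dvd cub_poly s" "p dvd cub_eval s x"
proof -
  define s where "s = r\<^sup>2 - 2"
  define t where "t = s\<^sup>2 - 2"
  have s: "p dvd cub_poly s" and t: "p dvd cub_poly t"
    using r by (simp_all add: s_def t_def cub_poly_conj)
  define u v w where uvw: "u = cub_eval r x" "v = cub_eval r (cub_conj x)" "w = cub_eval r (cub_conj (cub_conj x))"
  have "p dvd u * v - cub_eval r (x * cub_conj x)"
    unfolding uvw by (rule cub_eval_mod_mult[OF r])
  then have 1: "p dvd u * v * w - cub_eval r (x * cub_conj x) * w"
    by (metis dvd_mult2 left_diff_distrib)
  have "p dvd cub_eval r (x * cub_conj x) * w - cub_eval r (x * cub_conj x * cub_conj (cub_conj x))"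
    unfolding uvw by (rule cub_eval_mod_mult[OF r])
  then have 2: "p dvd cub_eval r (x * cub_conj x) * w - cub_norm x"
    by (simp flip: cub_norm_conj)
  have "p dvd u * v * w"
    using dvd_add[OF dvd_add[OF 1 2] dvd] by simp
  then have "p dvd u \<or> p dvd v \<or> p dvd w"
    using p prime_dvd_mult_iff by blast
  moreover have conj: "p dvd cub_eval (q\<^sup>2 - 2) z" if "p dvd cub_poly q" "p dvd cub_eval q (cub_conj z)" for q z
    using cub_eval_conj_diff[of q z] that by (metis dvd_add_right_iff dvd_mult2 diff_add_cancel)
  ultimately show thesis
  proof (elim disjE)
    assume "p dvd u"
    then show thesis
      using r that by (simp add: uvw)
  next
    assume "p dvd v"
    then have "p dvd cub_eval s x"
      using conj[OF r] by (simp add: uvw s_def)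
    then show thesis
      using s that by blast
  next
    assume "p dvd w"
    then have "p dvd cub_eval t x"
      using conj[OF s, of x] conj[OF r, of "cub_conj x"] by (simp add: uvw s_def t_def)
    then show thesis
      using t that by blast
  qed
qed

text \<open>A nonzero element of least absolute norm in the kernel of reduction at r generates it,
  by Euclidean division.\<close>

lemma cub_prime_ideal_generator:
  fixes p r :: int
  assumes p: "prime p" and r: "p dvd cub_poly r"
  obtains g where "g \<noteq> 0" "p dvd cub_norm g" "\<And>x. p dvd cub_eval r x \<Longrightarrow> g dvd x"
proof -
  define P where "P x \<longleftrightarrow> x \<noteq> 0 \<and> p dvd cub_eval r x" for x
  have "P (of_int p)"
    using p by (auto simp: P_def cub_eq_iff)
  then obtain g where g: "P g" "\<And>x. P x \<Longrightarrow> nat \<bar>cub_norm g\<bar> \<le> nat \<bar>cub_norm x\<bar>"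
    using ex_has_least_nat[of P "of_int p" "\<lambda>x. nat \<bar>cub_norm x\<bar>"] by blast
  have mult: "p dvd cub_eval r (q * x)" if "p dvd cub_eval r x" for q x
    using cub_eval_mod_mult[OF r, of q x] that by (metis dvd_diffD1 dvd_mult dvd_diff_commute dvd_diff diff_diff_eq2 add_diff_cancel_left')
  show thesis
  proof
    show "g \<noteq> 0"
      using g(1) by (simp add: P_def)
    have "p dvd cub_eval r (cub_adj g * g)"
      using g(1) by (intro mult) (simp add: P_def)
    then show "p dvd cub_norm g"
      by (simp add: mult.commute flip: cub_norm_adj)
    fix x
    assume x: "p dvd cub_eval r x"
    obtain q where q: "\<bar>cub_norm (x - q * g)\<bar> < \<bar>cub_norm g\<bar>"
      using cub_division[OF \<open>g \<noteq> 0\<close>] by blast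
    have "p dvd cub_eval r (x - q * g)"
      using x mult[of g q] g(1) by (simp add: P_def cub_eval_diff)
    then have "x - q * g = 0"
      using g(2)[of "x - q * g"] q by (cases "x - q * g = 0") (simp_all add: P_def)
    then show "g dvd x"
      by (metis dvd_triv_right eq_iff_diff_eq_0)
  qed
qed

theorem cub_totpos_is_nrd:
  assumes "cub_totpos l"
  shows "\<exists>x :: cub hq. nrd x = l"
  using assms
proof (induction "nat (cub_norm l)" arbitrary: l rule: less_induct)
  case less
  have Npos: "cub_norm l > 0"
    using cub_totpos_imp[OF less.prems] by simp
  have step: "\<exists>x :: cub hq. nrd x = l"
    if fac: "l = g * m" "cub_totpos g" "cub_norm g \<noteq> 1" and rep: "\<exists>x :: cub hq. nrd x = g" for g m
  proof -
    have m: "cub_totpos m"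
      using cub_totpos_divide less.prems fac by blast
    have "cub_norm g > 1" "cub_norm m > 0"
      using cub_totpos_imp[OF m] cub_totpos_imp[OF fac(2)] fac(3) by simp_all
    then have "cub_norm m < cub_norm l"
      unfolding fac(1) cub_norm_mult by simp
    then obtain y :: "cub hq" where "nrd y = m"
      using less.hyps[of m] m Npos by auto
    moreover obtain z :: "cub hq" where "nrd z = g"
      using rep by blast
    ultimately have "nrd (z * y) = l"
      by (simp add: nrd_mult fac(1))
    then show ?thesis
      by blast
  qed
  show ?case
  proof (cases "cub_norm l = 1")
    case True
    then have "l dvd 1"
      using cub_norm_adj[of l] by (metis dvd_triv_left of_int_1)
    \<comment> \<open>Units also go through the lattice argument, as divisors of rho itself.\<close>
    then have "l dvd cub_rho - of_int 0"
      by (metis dvd_trans one_dvd)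
    then show ?thesis
      using nrd_divisor less.prems by blast
  next
    case False
    then obtain p :: int where p: "prime p" "p dvd cub_norm l"
      using Npos prime_divisor_exists[of "cub_norm l"] by (cases "l = 0") auto
    show ?thesis
    proof (cases "\<exists>r. p dvd cub_poly r")
      case True
      then obtain r where r: "p dvd cub_poly r" "p dvd cub_eval r l"
        using prime_dvd_norm_split[OF p(1) _ p(2)] by blast
      obtain g where g: "g \<noteq> 0" "p dvd cub_norm g" "\<And>x. p dvd cub_eval r x \<Longrightarrow> g dvd x"
        using cub_prime_ideal_generator[OF p(1) r(1)] by blast
      obtain e e' where e: "e * e' = 1" "cub_totpos (e * g)"
        using cub_make_totpos[OF g(1)] by blast
      have dvd: "e * g dvd x" if "p dvd cub_eval r x" for x
      proof -
        obtain y where "x = g * y"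
          using g(3) \<open>p dvd cub_eval r x\<close> by blast
        then have "x = (e * g) * (e' * y)"
          using e(1) by (metis mult.assoc mult.left_commute mult_1)
        then show ?thesis
          by simp
      qed
      \<comment> \<open>rho - r vanishes at r and so lies in the prime ideal.\<close>
      have "e * g dvd cub_rho - of_int r"
        by (intro dvd) (simp add: cub_eval_diff)
      then have rep: "\<exists>x :: cub hq. nrd x = e * g"
        using nrd_divisor e(2) by blast
      have "p dvd cub_norm (e * g)"
        using g(2) by (simp add: cub_norm_mult)
      then have "cub_norm (e * g) \<noteq> 1"
        using p(1) not_prime_unit by metis
      moreover obtain m where "l = e * g * m"
        using dvd[OF r(2)] by blast
      ultimately show ?thesis
        using step e(2) rep by blast
    next
      case False
      then obtain m where m: "l = of_int p * m"
        using prime_dvd_norm_inert[OF p(1) _ p(2)] by blast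
      have p1: "p > 1"
        using p(1) by (simp add: prime_gt_1_int)
      obtain b :: "int hq" where "nrd b = p"
        using prime_is_nrd[OF p(1)] by blast
      then have "nrd (hq_int b) = of_int p"
        by (simp add: nrd_hq_int)
      moreover have "cub_totpos (of_int p)"
        using p1 by (simp add: cub_totpos_def)
      moreover have "cub_norm (of_int p) \<noteq> 1"
        using one_less_power[OF p1, of 3] by simp
      ultimately show ?thesis
        using step[OF m] by blast
    qed
  qed
qed

section \<open>Integrality\<close>

text \<open>If all powers of b/a have the common denominator C, every power of the reduced
  denominator divides C, so it is a unit.\<close>

lemma int_dvd_if_powers_dvd:
  fixes a b C :: int
  assumes "C \<noteq> 0" "\<And>k. a ^ k dvd C * b ^ k"
  shows "a dvd b"
proof (cases "a = 0")
  case True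
  then show ?thesis
    using assms(2)[of 1] assms(1) by simp
next
  case False
  obtain a' b' where ab: "a = a' * gcd a b" "b = b' * gcd a b" "coprime a' b'"
    using gcd_coprime_exists[of a b] False by auto
  have dvd: "a' ^ k dvd C" for k
  proof -
    have "a' ^ k * gcd a b ^ k dvd C * (b' ^ k * gcd a b ^ k)"
      using assms(2)[of k] ab(1,2) by (metis power_mult_distrib)
    then have "a' ^ k dvd C * b' ^ k"
      using False by (simp flip: mult.assoc)
    then show ?thesis
      using ab(3) by (simp add: coprime_dvd_mult_left_iff)
  qed
  have "\<bar>a'\<bar> \<le> 1"
  proof (rule ccontr)
    assume "\<not> \<bar>a'\<bar> \<le> 1"
    then have "2 ^ nat \<bar>C\<bar> \<le> \<bar>a'\<bar> ^ nat \<bar>C\<bar>"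
      by (intro power_mono) auto
    also have "\<dots> \<le> \<bar>C\<bar>"
      using dvd_imp_le_int[OF assms(1) dvd[of "nat \<bar>C\<bar>"]] by (simp add: power_abs)
    also have "\<dots> < 2 ^ nat \<bar>C\<bar>"
      using of_nat_less_two_power[of "nat \<bar>C\<bar>", where ?'a = int] by simp
    finally show False
      by simp
  qed
  moreover have "a' \<noteq> 0"
    using ab(1) False by auto
  ultimately have "is_unit a'"
    by simp
  then show ?thesis
    using ab(1,2) by (metis dvd_triv_right mult_unit_dvd_iff mult.commute)
qed

text \<open>\<open>cub_almost_int n v\<close> means that the powers of \<open>v/n\<close> have a common denominator.\<close>

definition cub_almost_int :: "int \<Rightarrow> cub \<Rightarrow> bool" where
  "cub_almost_int n v \<longleftrightarrow> (\<exists>M::int. M \<noteq> 0 \<and> (\<forall>k. of_int (n ^ k) dvd of_int M * v ^ k))"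

lemma cub_almost_int_combine:
  assumes "cub_almost_int n v"
  shows "cub_almost_int n (z * v + of_int n * w)"
proof -
  obtain M where M: "M \<noteq> 0" "\<And>k. of_int (n ^ k) dvd of_int M * v ^ k"
    using assms unfolding cub_almost_int_def by blast
  have "of_int (n ^ k) dvd of_int M * (z * v + of_int n * w) ^ k" for k
  proof -
    have "of_int M * (z * v + of_int n * w) ^ k =
        (\<Sum>i\<le>k. of_int M * (of_nat (k choose i) * (z * v) ^ i * (of_int n * w) ^ (k - i)))"
      by (simp add: binomial_ring sum_distrib_left)
    also have "of_int (n ^ k) dvd \<dots>"
    proof (rule dvd_sum)
      fix i assume "i \<in> {..k}"
      then have "of_int (n ^ k) = (of_int (n ^ i) * of_int (n ^ (k - i)) :: cub)"
        by (simp flip: of_int_mult power_add)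
      moreover have "of_int (n ^ i) * of_int (n ^ (k - i)) dvd
          (of_int M * v ^ i) * (of_int (n ^ (k - i)) * (of_nat (k choose i) * z ^ i * w ^ (k - i)))"
        by (intro mult_dvd_mono M) simp
      moreover have "(of_int M * v ^ i) * (of_int (n ^ (k - i)) * (of_nat (k choose i) * z ^ i * w ^ (k - i)))
          = of_int M * (of_nat (k choose i) * (z * v) ^ i * (of_int n * w) ^ (k - i))"
        by (simp add: power_mult_distrib mult_ac)
      ultimately show "of_int (n ^ k) dvd of_int M * (of_nat (k choose i) * (z * v) ^ i * (of_int n * w) ^ (k - i))"
        by (simp only:)
    qed
    finally show ?thesis .
  qed
  then show ?thesis
    using M(1) unfolding cub_almost_int_def by blast
qed

lemma cub_almost_int_norm:
  assumes "cub_almost_int n v"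
  shows "n ^ 3 dvd cub_norm v"
proof -
  obtain M where M: "M \<noteq> 0" "\<And>k. of_int (n ^ k) dvd of_int M * v ^ k"
    using assms unfolding cub_almost_int_def by blast
  have dvd: "(n ^ 3) ^ k dvd M ^ 3 * cub_norm v ^ k" for k
  proof -
    obtain w where "of_int M * v ^ k = of_int (n ^ k) * w"
      using M(2) by blast
    then have eq: "cub_norm (of_int M) * cub_norm v ^ k = cub_norm (of_int (n ^ k)) * cub_norm w"
      by (metis cub_norm_mult cub_norm_power)
    have nk: "cub_norm (of_int (n ^ k)) = (n ^ 3) ^ k"
      unfolding cub_norm_of_int by (simp add: mult.commute flip: power_mult)
    have "M ^ 3 * cub_norm v ^ k = (n ^ 3) ^ k * cub_norm w"
      by (rule eq[unfolded nk cub_norm_of_int[of M]])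
    then show ?thesis
      by simp
  qed
  show ?thesis
    by (rule int_dvd_if_powers_dvd[OF _ dvd]) (simp add: M(1))
qed

text \<open>With x = v/n the norms of x, x + 1 and x - 1 are integers, and N(x+1) + N(x-1) - 2 N(x)
  = 2 Tr(x). This is the origin of the factor 2.\<close>

lemma cub_almost_int_trace:
  assumes v: "cub_almost_int n v" and n: "n \<noteq> 0"
  shows "n dvd cub_trace (2 * v)"
proof -
  have norm: "cub_norm (v + of_int k) = k ^ 3 + k\<^sup>2 * cub_trace v + k * cub_pairs v + cub_norm v" for k
    by (simp add: cub_norm_def cub_trace_def cub_pairs_def Let_def algebra_simps power2_eq_square power3_eq_cube)
  have 1: "n ^ 3 dvd cub_norm (v + of_int n)"
    using cub_almost_int_norm[OF cub_almost_int_combine[OF v, of 1 1]] by simp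
  have 2: "n ^ 3 dvd cub_norm (v + of_int (- n))"
    using cub_almost_int_norm[OF cub_almost_int_combine[OF v, of 1 "- 1"]] by simp
  have "n ^ 3 dvd cub_norm (v + of_int n) + cub_norm (v + of_int (- n)) - 2 * cub_norm v"
    by (intro dvd_diff dvd_add 1 2 dvd_mult cub_almost_int_norm[OF v])
  also have "cub_norm (v + of_int n) + cub_norm (v + of_int (- n)) - 2 * cub_norm v = n\<^sup>2 * (2 * cub_trace v)"
    unfolding norm by simp
  finally have "n\<^sup>2 * n dvd n\<^sup>2 * (2 * cub_trace v)"
    by (simp add: power2_eq_square power3_eq_cube)
  then have "n dvd 2 * cub_trace v"
    using n by simp
  then show ?thesis
    using cub_trace_of_int_mult[of 2 v] by simp
qed

text \<open>The prime \<open>2 - \<rho>\<close> above 7 is totally ramified.\<close>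

lemma cub_almost_int_cancel_7:
  assumes v: "cub_almost_int n v" and n: "n \<noteq> 0" and dvd: "of_int n dvd (2 - cub_rho) * v"
  shows "of_int n dvd v"
proof -
  obtain w where w: "(2 - cub_rho) * v = of_int n * w"
    using dvd by blast
  define k where "k = cub_eval (2::int) w"
  \<comment> \<open>Dividing w by 2 - rho leaves the integer remainder k = w(2); comparing norms
    will show that 7 divides k.\<close>
  define s where "s = Cub (cf1 w + 2 * cf2 w) (cf2 w) 0"
  have ws: "w + (2 - cub_rho) * s = of_int k"
    by (simp add: cub_eq_iff k_def s_def cub_eval_def cub_sel_times)
  have "(2 - cub_rho) * (v + of_int n * s) = (2 - cub_rho) * v + of_int n * ((2 - cub_rho) * s)"
    by (simp only: distrib_left mult.left_commute)
  then have eq: "(2 - cub_rho) * (v + of_int n * s) = of_int n * of_int k"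
    by (simp only: w ws flip: distrib_left)
  have N7: "cub_norm (2 - cub_rho) = 7"
    by (simp add: cub_norm_def)
  have "cub_almost_int n (v + of_int n * s)"
    using cub_almost_int_combine[OF v, of 1 s] by simp
  then obtain c where c: "cub_norm (v + of_int n * s) = n ^ 3 * c"
    using cub_almost_int_norm by blast
  have "7 * (n ^ 3 * c) = n ^ 3 * k ^ 3"
    using arg_cong[OF eq, of cub_norm] unfolding cub_norm_mult N7 c by simp
  then have "k ^ 3 = 7 * c"
    using n by (metis mult.left_commute mult_left_cancel power_not_zero)
  moreover have "prime (7 :: int)"
    by simp
  ultimately have "7 dvd k"
    by (metis dvd_triv_left prime_dvd_power)
  then obtain j where j: "k = 7 * j"
    by blast
  \<comment> \<open>The cubic has the value 7 at 2 and 0 at rho; the cofactor is the difference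
    quotient.\<close>
  have seven: "(7 :: cub) = (2 - cub_rho) * Cub 4 3 1"
    by (simp add: cub_eq_iff cub_sel_times)
  have "(2 - cub_rho) * (v + of_int n * s) = (2 - cub_rho) * (of_int n * (Cub 4 3 1 * of_int j))"
    unfolding eq j by (simp add: seven mult_ac)
  moreover have "2 - cub_rho \<noteq> 0"
    using N7 by auto
  ultimately have "v + of_int n * s = of_int n * (Cub 4 3 1 * of_int j)"
    by simp
  then have "v = of_int n * (Cub 4 3 1 * of_int j - s)"
    by (simp add: algebra_simps)
  then show ?thesis
    by simp
qed

text \<open>The traces of u, rho u, rho^2 u determine u up to the different, an associate of (2 -
  rho)^2, which \<open>cub_almost_int_cancel_7\<close> removes in two steps; then the factor 2 in u
  = 2v remains.\<close>

theorem cub_almost_int_dvd: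
  assumes v: "cub_almost_int n v" and n: "n \<noteq> 0"
  shows "of_int n dvd v"
proof -
  have mult: "cub_almost_int n (z * v)" for z
    using cub_almost_int_combine[OF v, of z 0] by simp
  define u where "u = 2 * v"
  have tr: "n dvd cub_trace (z * u)" for z
    using cub_almost_int_trace[OF mult[of z] n] by (simp add: u_def mult_ac)
  define t0 t1 t2 where t: "t0 = cub_trace (1 * u)" "t1 = cub_trace (cub_rho * u)" "t2 = cub_trace (cub_rho * cub_rho * u)"
  \<comment> \<open>Euler's dual basis: \<open>Cub (-2) 2 3\<close> is the derivative of the minimal polynomial at \<open>\<rho>\<close>.\<close>
  have "Cub (-2) 2 3 * u = of_int t0 * Cub (-2) 1 1 + of_int t1 * Cub 1 1 0 + of_int t2"
    by (simp add: cub_eq_iff cub_sel_times t cub_trace_def)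
  moreover have "of_int n dvd (of_int t0 * Cub (-2) 1 1 + of_int t1 * Cub 1 1 0 + of_int t2 :: cub)"
    using tr[of 1] tr[of cub_rho] tr[of "cub_rho * cub_rho"]
    unfolding t by (intro dvd_add dvd_mult2) (simp_all add: cub_of_int_dvd_iff)
  ultimately have "of_int n dvd Cub (-2) 2 3 * u"
    by simp
  \<comment> \<open>\<open>Cub (-3) 0 2\<close> is the unit that turns the different into (2 -
    rho)^2.\<close>
  then have "of_int n dvd Cub (-3) 0 2 * (Cub (-2) 2 3 * u)"
    by (rule dvd_mult)
  also have "Cub (-3) 0 2 * (Cub (-2) 2 3 * u) = (2 - cub_rho) * ((2 - cub_rho) * u)"
    by (simp add: cub_eq_iff cub_sel_times)
  finally have "of_int n dvd (2 - cub_rho) * ((2 - cub_rho) * u)" .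
  moreover have ai: "cub_almost_int n ((2 - cub_rho) * u)" "cub_almost_int n u"
    using mult[of "(2 - cub_rho) * 2"] mult[of 2] by (simp_all only: u_def mult.assoc)
  ultimately have "of_int n dvd u"
    using n cub_almost_int_cancel_7 by blast
  then obtain w where w: "2 * v = of_int n * w"
    unfolding u_def by blast
  obtain c where c: "cub_norm v = n ^ 3 * c"
    using cub_almost_int_norm[OF v] by blast
  \<comment> \<open>The norm of w is even, so the inert prime 2 divides w and cancels.\<close>
  have "8 * (n ^ 3 * c) = n ^ 3 * cub_norm w"
    using arg_cong[OF w, of cub_norm] unfolding cub_norm_mult c by simp
  then have "cub_norm w = 8 * c"
    using n by (metis mult.left_commute mult_left_cancel power_not_zero)
  then obtain w' where "w = 2 * w'"
    using even_cub_norm_imp[of w] by auto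
  then have "2 * v = 2 * (of_int n * w')"
    using w by (simp add: mult_ac)
  then have "v = of_int n * w'"
    by simp
  then show ?thesis
    by simp
qed

section \<open>Algebraic integers of the field as values of \<open>cub_eval\<close>\<close>

lemma cub_eval_power:
  "cub_poly r = 0 \<Longrightarrow> cub_eval r (x ^ k) = cub_eval r x ^ k"
  by (induction k) (simp_all add: cub_eval_mult)

lemma cub_eval_inject:
  assumes "cub_poly (r::'a::{comm_ring_1,ring_char_0}) = 0" "cub_eval r x = cub_eval r y"
  shows "x = y"
  using cub_eval_eq_0_iff[OF assms(1), of "x - y"] assms(2) by (simp add: cub_eval_diff)

text \<open>With a monic integer equation of degree d, n^d is a common denominator for all powers of
  x: directly below d, and by the recurrence from d on.\<close>

theorem algebraic_int_imp_cub_eval: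
  fixes r x :: "'a::field_char_0"
  assumes r: "cub_poly r = 0" and x: "x = cub_eval r v / of_int n" and n: "n \<noteq> 0"
    and "algebraic_int x"
  shows "\<exists>w. x = cub_eval r w"
proof -
  obtain p :: "int poly" where p: "poly (map_poly of_int p) x = 0" "lead_coeff p = 1"
    using \<open>algebraic_int x\<close> unfolding algebraic_int_altdef_ipoly by blast
  define d where "d = degree p"
  have nx: "of_int n * x = cub_eval r v"
    using n by (simp add: x)
  have closed: "\<exists>w. cub_eval r w = of_int n ^ d * x ^ k" for k
  proof (induction k rule: less_induct)
    case (less k)
    show ?case
    proof (cases "k < d")
      case True
      have "cub_eval r (of_int (n ^ (d - k)) * v ^ k) = of_int n ^ (d - k) * (of_int n * x) ^ k"
        by (simp only: cub_eval_mult[OF r] cub_eval_power[OF r] nx cub_eval_of_int of_int_power)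
      also have "\<dots> = of_int n ^ (d - k + k) * x ^ k"
        by (simp only: power_add power_mult_distrib mult.assoc)
      also have "d - k + k = d"
        using True by simp
      finally show ?thesis
        by blast
    next
      case False
      obtain g where g: "\<And>i. i < d \<Longrightarrow> cub_eval r (g i) = of_int n ^ d * x ^ (k - d + i)"
      proof -
        have "\<forall>i. \<exists>w. i < d \<longrightarrow> cub_eval r w = of_int n ^ d * x ^ (k - d + i)"
          using less False by (metis add.commute le_add_diff_inverse2 nat_add_left_cancel_less not_less)
        then show thesis
          using that by metis
      qed
      have "0 = (\<Sum>i\<le>d. of_int (coeff p i) * x ^ i)"
        using p(1) by (simp add: poly_altdef d_def degree_map_poly coeff_map_poly)
      also have "\<dots> = (\<Sum>i<d. of_int (coeff p i) * x ^ i) + x ^ d"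
        using p(2) by (simp add: lessThan_Suc_atMost[symmetric] d_def)
      finally have xd: "x ^ d = - (\<Sum>i<d. of_int (coeff p i) * x ^ i)"
        by (metis add.inverse_unique add.commute)
      have "of_int n ^ d * x ^ k = of_int n ^ d * (x ^ (k - d) * x ^ d)"
        using False by (simp flip: power_add)
      also have "\<dots> = - (\<Sum>i<d. of_int (coeff p i) * (of_int n ^ d * x ^ (k - d + i)))"
        unfolding xd by (simp add: sum_distrib_left power_add mult_ac)
      also have "\<dots> = - (\<Sum>i<d. of_int (coeff p i) * cub_eval r (g i))"
        by (simp add: g)
      also have "\<dots> = cub_eval r (- (\<Sum>i<d. of_int (coeff p i) * g i))"
      proof -
        have "cub_eval r (\<Sum>i<m. of_int (coeff p i) * g i) = (\<Sum>i<m. of_int (coeff p i) * cub_eval r (g i))" for m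
          by (induction m) (simp_all add: cub_eval_add cub_eval_mult[OF r])
        then show ?thesis
          by (simp add: cub_eval_uminus)
      qed
      finally show ?thesis
        by metis
    qed
  qed
  have "of_int (n ^ k) dvd of_int (n ^ d) * v ^ k" for k
  proof -
    obtain w where w: "cub_eval r w = of_int n ^ d * x ^ k"
      using closed by blast
    have "cub_eval r (of_int (n ^ d) * v ^ k) = of_int n ^ d * (of_int n * x) ^ k"
      by (simp only: cub_eval_mult[OF r] cub_eval_power[OF r] nx cub_eval_of_int of_int_power)
    also have "\<dots> = of_int n ^ k * cub_eval r w"
      by (simp only: w power_mult_distrib mult_ac)
    also have "\<dots> = cub_eval r (of_int (n ^ k) * w)"
      unfolding cub_eval_mult[OF r] cub_eval_of_int by simp
    finally have "of_int (n ^ d) * v ^ k = of_int (n ^ k) * w"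
      by (rule cub_eval_inject[OF r])
    then show ?thesis
      by simp
  qed
  then have "cub_almost_int n v"
    using n unfolding cub_almost_int_def by (intro exI[of _ "n ^ d"]) auto
  then obtain w where "v = of_int n * w"
    using cub_almost_int_dvd n by blast
  then have "x = cub_eval r w"
    using n by (simp add: x cub_eval_mult[OF r])
  then show ?thesis
    by blast
qed

lemma algebraic_int_cub_eval:
  fixes r :: "'a::field_char_0"
  assumes r: "cub_poly r = 0"
  shows "algebraic_int (cub_eval r w)"
proof -
  define p :: "int poly" where "p = [:- cub_norm w, cub_pairs w, - cub_trace w, 1:]"
  have "poly (map_poly of_int p) (cub_eval r w) = 0"
    by (simp add: p_def map_poly_pCons cub_eval_norm[OF r] cub_eval_pairs[OF r] cub_eval_trace[OF r] algebra_simps)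
  moreover have "lead_coeff p = 1"
    by (simp add: p_def)
  ultimately show ?thesis
    unfolding algebraic_int_altdef_ipoly by blast
qed

section \<open>The field generated by \<open>\<rho>\<close>\<close>

lemma ring_of_type_algebra_sel [simp]:
  "carrier (ring_of_type_algebra :: 'a::ring_1 ring) = UNIV"
  "x \<otimes>\<^bsub>(ring_of_type_algebra :: 'a ring)\<^esub> y = x * y"
  "\<one>\<^bsub>(ring_of_type_algebra :: 'a ring)\<^esub> = 1"
  "\<zero>\<^bsub>(ring_of_type_algebra :: 'a ring)\<^esub> = 0"
  "x \<oplus>\<^bsub>(ring_of_type_algebra :: 'a ring)\<^esub> y = x + y"
  by (simp_all add: ring_of_type_algebra_def)

lemma a_inv_ring_of_type_algebra:
  "\<ominus>\<^bsub>(ring_of_type_algebra :: complex ring)\<^esub> x = - x"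
proof -
  interpret cring "ring_of_type_algebra :: complex ring"
    by (rule cring_from_type_algebra)
  show ?thesis
    by (rule minus_equality) simp_all
qed

lemma m_inv_ring_of_type_algebra:
  assumes "x \<noteq> 0"
  shows "inv\<^bsub>(ring_of_type_algebra :: complex ring)\<^esub> x = inverse x"
proof -
  interpret cring "ring_of_type_algebra :: complex ring"
    by (rule cring_from_type_algebra)
  show ?thesis
    using assms by (intro comm_inv_char) simp_all
qed

lemma rat_adjoin_closed:
  "x \<in> rat_adjoin a \<Longrightarrow> y \<in> rat_adjoin a \<Longrightarrow> x + y \<in> rat_adjoin a"
  "x \<in> rat_adjoin a \<Longrightarrow> y \<in> rat_adjoin a \<Longrightarrow> x * y \<in> rat_adjoin a"
  "x \<in> \<rat> \<Longrightarrow> x \<in> rat_adjoin a" "a \<in> rat_adjoin a"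
  unfolding rat_adjoin_def
  using generate_field.eng_add[of x "ring_of_type_algebra :: complex ring" _ y]
    generate_field.eng_mult[of x "ring_of_type_algebra :: complex ring" _ y]
  by (auto intro: generate_field.incl)

lemma cub_eval_in_rat_adjoin: "cub_eval r v \<in> rat_adjoin r"
  unfolding cub_eval_def power2_eq_square
  by (intro rat_adjoin_closed(1,2)) (auto intro: rat_adjoin_closed(3,4))

lemma rat_adjoin_cub:
  assumes r: "cub_poly r = 0" and "x \<in> rat_adjoin r"
  shows "\<exists>v n. n \<noteq> 0 \<and> x = cub_eval r v / of_int n"
  using assms(2) unfolding rat_adjoin_def
proof (induction rule: generate_field.induct)
  case one
  show ?case
    by (rule exI[of _ 1], rule exI[of _ 1]) simp
next
  case (incl h)
  then consider "h \<in> \<rat>" | "h = r"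
    by blast
  then show ?case
  proof cases
    case 1
    then obtain a b :: int where "b > 0" "h = of_int a / of_int b"
      by (metis Rats_cases')
    then show ?thesis
      by (intro exI[of _ "of_int a"] exI[of _ b]) simp
  next
    case 2
    then show ?thesis
      by (intro exI[of _ cub_rho] exI[of _ 1]) simp
  qed
next
  case (a_inv h)
  then obtain v n where "n \<noteq> 0" "h = cub_eval r v / of_int n"
    by blast
  then show ?case
    by (intro exI[of _ "- v"] exI[of _ n]) (simp add: a_inv_ring_of_type_algebra cub_eval_uminus)
next
  case (m_inv h)
  then obtain v n where v: "n \<noteq> 0" "h = cub_eval r v / of_int n"
    by blast
  with m_inv have "v \<noteq> 0"
    by auto
  have N: "cub_eval r v * cub_eval r (cub_adj v) = of_int (cub_norm v)"
    using cub_norm_adj[of v] by (metis cub_eval_mult[OF r] cub_eval_of_int)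
  have "cub_eval r (cub_adj v) \<noteq> 0"
    using N \<open>v \<noteq> 0\<close> by auto
  \<comment> \<open>Expanding by the adjugate makes the denominator the rational integer
    \<open>cub_norm v\<close>.\<close>
  then have "inverse h = (of_int n * cub_eval r (cub_adj v)) / (cub_eval r v * cub_eval r (cub_adj v))"
    by (simp add: v(2))
  then have "inverse h = cub_eval r (of_int n * cub_adj v) / of_int (cub_norm v)"
    by (simp add: N cub_eval_mult[OF r])
  then show ?case
    using \<open>v \<noteq> 0\<close> m_inv
    by (intro exI[of _ "of_int n * cub_adj v"] exI[of _ "cub_norm v"]) (simp add: m_inv_ring_of_type_algebra)
next
  case (eng_add h1 h2)
  then obtain v n w m where "n \<noteq> 0" "h1 = cub_eval r v / of_int n" "m \<noteq> 0" "h2 = cub_eval r w / of_int m"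
    by blast
  then show ?case
    by (intro exI[of _ "of_int m * v + of_int n * w"] exI[of _ "n * m"])
      (simp add: cub_eval_add cub_eval_mult[OF r] field_simps)
next
  case (eng_mult h1 h2)
  then obtain v n w m where "n \<noteq> 0" "h1 = cub_eval r v / of_int n" "m \<noteq> 0" "h2 = cub_eval r w / of_int m"
    by blast
  then show ?case
    by (intro exI[of _ "v * w"] exI[of _ "n * m"]) (simp add: cub_eval_mult[OF r])
qed

lemma ring_of_integers_cub:
  assumes r: "cub_poly r = 0"
  shows "ring_of_integers (rat_adjoin r) = range (cub_eval r)"
proof
  show "range (cub_eval r) \<subseteq> ring_of_integers (rat_adjoin r)"
    using algebraic_int_cub_eval[OF r] cub_eval_in_rat_adjoin by (auto simp: ring_of_integers_def)
  show "ring_of_integers (rat_adjoin r) \<subseteq> range (cub_eval r)"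
  proof
    fix x assume "x \<in> ring_of_integers (rat_adjoin r)"
    then have x: "x \<in> rat_adjoin r" "algebraic_int x"
      by (simp_all add: ring_of_integers_def)
    obtain v n where "n \<noteq> 0" "x = cub_eval r v / of_int n"
      using rat_adjoin_cub[OF r x(1)] by blast
    then show "x \<in> range (cub_eval r)"
      using algebraic_int_imp_cub_eval[OF r _ _ x(2)] by blast
  qed
qed

text \<open>Every real root comes from an embedding of the field, so total positivity over K yields
  \<open>cub_totpos\<close>. The map is read off from any representation v/n, its value being
  independent of the choice.\<close>

lemma real_embedding_cub:
  fixes s :: real
  assumes r: "cub_poly r = 0" and s: "cub_poly s = 0"
  obtains \<sigma> where "\<sigma> \<in> real_embeddings (rat_adjoin r)" "\<And>v. \<sigma> (cub_eval r v) = cub_eval s v"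
proof -
  define R where "R x y \<longleftrightarrow> (\<exists>v n. n \<noteq> 0 \<and> x = cub_eval r v / of_int n \<and> y = cub_eval s v / of_int n)"
    for x :: complex and y :: real
  have unique: "y = y'" if R: "R x y" "R x y'" for x y y'
  proof -
    obtain v n w m where v: "n \<noteq> 0" "x = cub_eval r v / of_int n" "y = cub_eval s v / of_int n"
      and w: "m \<noteq> 0" "x = cub_eval r w / of_int m" "y' = cub_eval s w / of_int m"
      using R unfolding R_def by blast
    have "cub_eval r (of_int m * v) = cub_eval r (of_int n * w)"
      using v w by (simp add: cub_eval_mult[OF r] field_simps)
    then have "of_int m * v = of_int n * w"
      by (rule cub_eval_inject[OF r])
    then have "of_int m * cub_eval s v = of_int n * cub_eval s w"
      by (metis cub_eval_mult[OF s] cub_eval_of_int)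
    then show ?thesis
      using v(1) w(1) unfolding v(3) w(3) by (simp add: field_simps)
  qed
  define \<sigma> where "\<sigma> x = (THE y. R x y)" for x
  have sigma: "\<sigma> x = y" if "R x y" for x y
    unfolding \<sigma>_def using that unique by blast
  have ex: "\<exists>y. R x y" if "x \<in> rat_adjoin r" for x
    using rat_adjoin_cub[OF r that] unfolding R_def by blast
  have plus: "R (x + x') (y + y')" if R: "R x y" "R x' y'" for x y x' y'
  proof -
    obtain v n w m where v: "n \<noteq> 0" "x = cub_eval r v / of_int n" "y = cub_eval s v / of_int n"
      and w: "m \<noteq> 0" "x' = cub_eval r w / of_int m" "y' = cub_eval s w / of_int m"
      using R unfolding R_def by blast
    then show ?thesis
      unfolding R_def by (intro exI[of _ "of_int m * v + of_int n * w"] exI[of _ "n * m"])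
        (simp add: cub_eval_add cub_eval_mult[OF r] cub_eval_mult[OF s] field_simps)
  qed
  have times: "R (x * x') (y * y')" if R: "R x y" "R x' y'" for x y x' y'
  proof -
    obtain v n w m where v: "n \<noteq> 0" "x = cub_eval r v / of_int n" "y = cub_eval s v / of_int n"
      and w: "m \<noteq> 0" "x' = cub_eval r w / of_int m" "y' = cub_eval s w / of_int m"
      using R unfolding R_def by blast
    then show ?thesis
      unfolding R_def by (intro exI[of _ "v * w"] exI[of _ "n * m"])
        (simp add: cub_eval_mult[OF r] cub_eval_mult[OF s])
  qed
  have eval: "R (cub_eval r v) (cub_eval s v)" for v
    unfolding R_def by (intro exI[of _ v] exI[of _ 1]) simp
  show thesis
  proof
    show "\<sigma> (cub_eval r v) = cub_eval s v" for v
      using sigma eval by blast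
    have "\<sigma> 1 = 1"
      using sigma[OF eval[of 1]] by simp
    moreover have "\<sigma> (x + y) = \<sigma> x + \<sigma> y" "\<sigma> (x * y) = \<sigma> x * \<sigma> y"
      if "x \<in> rat_adjoin r" "y \<in> rat_adjoin r" for x y
      using ex[OF that(1)] ex[OF that(2)] plus times sigma by metis+
    ultimately show "\<sigma> \<in> real_embeddings (rat_adjoin r)"
      unfolding real_embeddings_def by (intro ring_hom_memI) simp_all
  qed
qed

text \<open>The cubic at \<zeta> + 1/\<zeta>, multiplied by \<zeta>^3, is the seventh cyclotomic
  polynomial at \<zeta>.\<close>

lemma cub_poly_root_of_unity:
  fixes \<zeta> :: complex
  assumes "primitive_root_of_unity 7 \<zeta>"
  shows "cub_poly (\<zeta> + inverse \<zeta>) = 0"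
proof -
  have z7: "\<zeta> ^ 7 = 1" and z1: "\<zeta> \<noteq> 1"
    using assms unfolding primitive_root_of_unity_def
    by (auto dest!: spec[of _ "1::nat"])
  then have z0: "\<zeta> \<noteq> 0"
    by auto
  have "(\<zeta> - 1) * (\<zeta>^6 + \<zeta>^5 + \<zeta>^4 + \<zeta>^3 + \<zeta>\<^sup>2 + \<zeta> + 1) = \<zeta> ^ 7 - 1"
    by (simp add: algebra_simps eval_nat_numeral)
  then have sum0: "\<zeta>^6 + \<zeta>^5 + \<zeta>^4 + \<zeta>^3 + \<zeta>\<^sup>2 + \<zeta> + 1 = 0"
    using z7 z1 by simp
  define t where "t = \<zeta> + inverse \<zeta>"
  have t: "\<zeta> * t = \<zeta>\<^sup>2 + 1"
    using z0 by (simp add: t_def distrib_left power2_eq_square)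
  have "\<zeta>^3 * cub_poly t = (\<zeta> * t)^3 + \<zeta> * (\<zeta> * t)\<^sup>2 - 2 * \<zeta>\<^sup>2 * (\<zeta> * t) - \<zeta>^3"
    by (simp add: cub_poly_def algebra_simps eval_nat_numeral)
  also have "\<dots> = \<zeta>^6 + \<zeta>^5 + \<zeta>^4 + \<zeta>^3 + \<zeta>\<^sup>2 + \<zeta> + 1"
    unfolding t by (simp add: algebra_simps eval_nat_numeral)
  finally show ?thesis
    using z0 sum0 by (simp add: t_def)
qed

theorem theorem6p2:
  fixes \<zeta> :: complex and K :: "complex set"
  assumes "primitive_root_of_unity 7 \<zeta>"
    and "K = rat_adjoin (\<zeta> + inverse \<zeta>)"
  shows "\<forall>l\<in>ring_of_integers K. totally_positive K l \<longrightarrow>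
    (\<exists>x\<in>ring_of_integers K. \<exists>y\<in>ring_of_integers K.
     \<exists>z\<in>ring_of_integers K. \<exists>w\<in>ring_of_integers K.
       x\<^sup>2 + x * y + y\<^sup>2 + y * z - x * w + z\<^sup>2 + z * w + w\<^sup>2 = l)"
proof (intro ballI impI)
  fix l assume l: "l \<in> ring_of_integers K" "totally_positive K l"
  define r where "r = \<zeta> + inverse \<zeta>"
  have r: "cub_poly r = 0" and K: "K = rat_adjoin r"
    using cub_poly_root_of_unity assms by (simp_all add: r_def)
  obtain v where v: "l = cub_eval r v"
    using l(1) by (auto simp: K ring_of_integers_cub[OF r])
  have "cub_totpos v"
    unfolding cub_totpos_def
  proof (intro allI impI)
    fix s :: real assume "cub_poly s = 0"
    then obtain \<sigma> where "\<sigma> \<in> real_embeddings K" "\<sigma> l = cub_eval s v"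
      using real_embedding_cub[OF r] v K by metis
    then show "cub_eval s v > 0"
      using l(2) unfolding totally_positive_def by metis
  qed
  then obtain q where q: "nrd q = v"
    using cub_totpos_is_nrd by blast
  have O: "cub_eval r u \<in> ring_of_integers K" for u
    by (simp add: K ring_of_integers_cub[OF r])
  have "nrd (map_hq (cub_eval r) q) = l"
    using cub_eval_nrd[OF r, of q] by (simp add: q v)
  then show "\<exists>x\<in>ring_of_integers K. \<exists>y\<in>ring_of_integers K.
     \<exists>z\<in>ring_of_integers K. \<exists>w\<in>ring_of_integers K.
       x\<^sup>2 + x * y + y\<^sup>2 + y * z - x * w + z\<^sup>2 + z * w + w\<^sup>2 = l"
    using O unfolding nrd_def map_hq_sel by blast
qed

end
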